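(* Let $\tau$ be an order $3$ automorphism of a Cayley algebra $(\mathcal{C},\cdot,n)$ over a field $\mathbb{F}$ of characteristic $3$ such that $(\tau-\mathrm{id})^2\neq 0$ and $\tau$ fixes elementwise a quadratic étale subalgebra. Then the Petersson algebra $\mathcal{C}_\tau$ is an Okubo algebra and $\tau$ is conjugate to an automorphism $\tau_{\mathcal{K},a}$ for some quadratic étale algebra $\mathcal{K}$ and some $a\in\mathcal{K}$ of norm $1$. Moreover, two such automorphisms $\tau_{\mathcal{K},a}$ and $\tau_{\mathcal{K}',a'}$ are conjugate if and only if there is an isomorphism $\varphi:\mathcal{K}\to\mathcal{K}'$ such that $\varphi(a)\in(\mathcal{K}')^{3}\cdot a'$ (i.e., there is an element $b'\in\mathcal{K}'$, necessarily of norm $1$, such that $\varphi(a)=(b')^3\cdot a'$).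
   Context: A Hurwitz algebra over $\mathbb{F}$ is a unital, not necessarily associative algebra $(\mathcal{C},\cdot)$ with a nonsingular quadratic form $n$ with $n(x\cdot y)=n(x)n(y)$; conjugation $\bar x=n(x,1)1-x$, where $n(x,y)=n(x+y)-n(x)-n(y)$. Dimension $2$: quadratic étale algebras; dimension $8$: Cayley algebras. Given an automorphism $\tau$ with $\tau^3=\mathrm{id}$, the Petersson algebra $\mathcal{C}_\tau$ is $(\mathcal{C},*,n)$ with $x*y=\tau(\bar x)\cdot\tau^2(\bar y)$. The split Cayley algebra has a canonical basis $e_1,e_2,u_1,u_2,u_3,v_1,v_2,v_3$ where $e_1,e_2$ are orthogonal idempotents with $e_1+e_2=1$, $e_1u_i=u_i=u_ie_2$, $e_2v_i=v_i=v_ie_1$, $e_2u_i=u_ie_1=e_1v_i=v_ie_2=0$, $u_iu_{i+1}=v_{i+2}=-u_{i+1}u_i$, $v_iv_{i+1}=u_{i+2}=-v_{i+1}v_i$ (indices modulo $3$), $u_i^2=v_i^2=0$, $u_iv_i=-e_1$, $v_iu_i=-e_2$, $u_iv_j=v_iu_j=0$ for $i\ne j$. Its automorphism $\tau_{st}$ fixes $e_1,e_2$ and maps $u_i\mapsto u_{i+1}$, $v_i\mapsto v_{i+1}$. The split Okubo algebra is $\mathcal{C}_{\tau_{st}}$ for the split Cayley algebra $\mathcal{C}$; an Okubo algebra is an algebra becoming isomorphic to it after an extension of scalars. Definition of $\tau_{\mathcal{K},a}$ ($\mathrm{char}\,\mathbb{F}=3$). Let $\mathcal{K}$ be a quadratic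 étale $\mathbb{F}$-algebra and $a\in\mathcal{K}$ with $n(a)=1$. Let $\mathcal{W}$ be a free left $\mathcal{K}$-module with basis $w_1,w_2,w_3$, let $\sigma:\mathcal{W}\times\mathcal{W}\to\mathcal{K}$ be the hermitian form ($\mathcal{K}$-linear in the first variable, $\sigma(y,x)=\overline{\sigma(x,y)}$) with $\sigma(w_i,w_i)=0$, $\sigma(w_i,w_j)=-1$ for $i\neq j$, and let $\Phi:\mathcal{W}^3\to\mathcal{K}$ be the alternating $\mathcal{K}$-trilinear form with $\Phi(w_1,w_2,w_3)=a$. Define $x\times y\in\mathcal{W}$ by $\sigma(z,x\times y)=\Phi(z,x,y)$ for all $z\in\mathcal{W}$. Then $\mathcal{K}\oplus\mathcal{W}$ is a Cayley algebra, isomorphic to the split Cayley algebra, with $\mathcal{K}$ a subalgebra, $b\cdot x$ the module action and $x\cdot b=\bar b\cdot x$ for $b\in\mathcal{K}$, $x\in\mathcal{W}$, $x\cdot y=-\sigma(x,y)+x\times y$ for $x,y\in\mathcal{W}$, and norm given by the norm of $\mathcal{K}$ on $\mathcal{K}$, $n(x)=\sigma(x,x)$ on $\mathcal{W}$, $\mathcal{K}\perp\mathcal{W}$. The automorphism $\tau_{\mathcal{K},a}$ is the order $3$ automorphism that is the identity on $\mathcal{K}$, is $\mathcal{K}$-linear on $\mathcal{W}$, and satisfies $w_1\mapsto w_2\mapsto w_3\mapsto w_1$. It is viewed as an automorphism of the split Cayley algebra (well defined up to conjugation) through any isomorphism. *)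

theory Defs
  imports
    "HOL-Analysis.Cartesian_Space"
    "HOL-Analysis.Product_Vector"
    "HOL-Algebra.Algebraic_Closure_Type"
begin

no_notation fps_nth (infixl \<open>$\<close> 75)

section \<open>Algebras, Hurwitz algebras, Petersson algebras\<close>

text \<open>An algebra has a full type as underlying additive group. The field of scalars is a type
  as well, so that \<^const>\<open>vector_space\<close> and its notion of dimension apply.\<close>

record ('f, 'c) alg =
  smul :: "'f \<Rightarrow> 'c \<Rightarrow> 'c"
  mul :: "'c \<Rightarrow> 'c \<Rightarrow> 'c"

record ('f, 'c) normed_alg = "('f, 'c) alg" +
  nrm :: "'c \<Rightarrow> 'f"

record ('f, 'c) unital_normed_alg = "('f, 'c) normed_alg" +
  unity :: "'c"

definition polar :: "('c::ab_group_add \<Rightarrow> 'f::field) \<Rightarrow> 'c \<Rightarrow> 'c \<Rightarrow> 'f" where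
  "polar n x y = n (x + y) - n x - n y"

text \<open>\<open>hurwitz_on A S\<close>: the subspace \<open>S\<close> of \<open>A\<close>, with the operations and the norm of \<open>A\<close>, is a
  Hurwitz algebra. Taking \<open>S = UNIV\<close> gives Hurwitz algebras, smaller \<open>S\<close> gives Hurwitz
  subalgebras. Nonsingularity is nondegeneracy of the polar form, which is the right notion in
  characteristic different from 2.\<close>

definition hurwitz_on ::
    "('f::field, 'c::ab_group_add, 'z) unital_normed_alg_scheme \<Rightarrow> 'c set \<Rightarrow> bool" where
  "hurwitz_on A S \<longleftrightarrow>
     vector_space (smul A) \<and> Modules.module.subspace (smul A) S \<and>
     unity A \<in> S \<and> (\<forall>x\<in>S. \<forall>y\<in>S. mul A x y \<in> S) \<and>
     (\<forall>x\<in>S. \<forall>y\<in>S. \<forall>z\<in>S. mul A (x + y) z = mul A x z + mul A y z \<and>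
        mul A z (x + y) = mul A z x + mul A z y) \<and>
     (\<forall>c. \<forall>x\<in>S. \<forall>y\<in>S. mul A (smul A c x) y = smul A c (mul A x y) \<and>
        mul A x (smul A c y) = smul A c (mul A x y)) \<and>
     (\<forall>x\<in>S. mul A (unity A) x = x \<and> mul A x (unity A) = x) \<and>
     (\<forall>c. \<forall>x\<in>S. nrm A (smul A c x) = c\<^sup>2 * nrm A x) \<and>
     (\<forall>x\<in>S. \<forall>y\<in>S. \<forall>z\<in>S. polar (nrm A) (x + y) z = polar (nrm A) x z + polar (nrm A) y z) \<and>
     (\<forall>c. \<forall>x\<in>S. \<forall>y\<in>S. polar (nrm A) (smul A c x) y = c * polar (nrm A) x y) \<and>
     (\<forall>x\<in>S. (\<forall>y\<in>S. polar (nrm A) x y = 0) \<longrightarrow> x = 0) \<and>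
     (\<forall>x\<in>S. \<forall>y\<in>S. nrm A (mul A x y) = nrm A x * nrm A y)"

definition quadratic_etale_on ::
    "('f::field, 'c::ab_group_add, 'z) unital_normed_alg_scheme \<Rightarrow> 'c set \<Rightarrow> bool" where
  "quadratic_etale_on A S \<longleftrightarrow> hurwitz_on A S \<and> vector_space.dim (smul A) S = 2"

abbreviation quadratic_etale ::
    "('f::field, 'c::ab_group_add, 'z) unital_normed_alg_scheme \<Rightarrow> bool" where
  "quadratic_etale A \<equiv> quadratic_etale_on A UNIV"

definition cayley_algebra ::
    "('f::field, 'c::ab_group_add, 'z) unital_normed_alg_scheme \<Rightarrow> bool" where
  "cayley_algebra A \<longleftrightarrow> hurwitz_on A UNIV \<and> vector_space.dim (smul A) UNIV = 8"

definition hconj ::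
    "('f::field, 'c::ab_group_add, 'z) unital_normed_alg_scheme \<Rightarrow> 'c \<Rightarrow> 'c" where
  "hconj A x = smul A (polar (nrm A) x (unity A)) (unity A) - x"

definition petersson ::
    "('f::field, 'c::ab_group_add, 'z) unital_normed_alg_scheme \<Rightarrow> ('c \<Rightarrow> 'c) \<Rightarrow>
      ('f, 'c) normed_alg" where
  "petersson C \<tau> =
     \<lparr>smul = smul C, mul = (\<lambda>x y. mul C (\<tau> (hconj C x)) (\<tau> (\<tau> (hconj C y)))), nrm = nrm C\<rparr>"

definition alg_iso ::
    "('f::field, 'a::ab_group_add, 'y) alg_scheme \<Rightarrow> ('f, 'b::ab_group_add, 'z) alg_scheme \<Rightarrow>
      ('a \<Rightarrow> 'b) \<Rightarrow> bool" where
  "alg_iso A B f \<longleftrightarrow> Vector_Spaces.linear (smul A) (smul B) f \<and> bij f \<and>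
     (\<forall>x y. f (mul A x y) = mul B (f x) (f y))"

abbreviation alg_automorphism ::
    "('f::field, 'a::ab_group_add, 'y) alg_scheme \<Rightarrow> ('a \<Rightarrow> 'a) \<Rightarrow> bool" where
  "alg_automorphism A f \<equiv> alg_iso A A f"

definition order_three :: "('a \<Rightarrow> 'a) \<Rightarrow> bool" where
  "order_three f \<longleftrightarrow> f \<noteq> id \<and> f \<circ> f \<circ> f = id"

text \<open>Conjugacy of an automorphism \<open>f\<close> of \<open>A\<close> with an automorphism \<open>g\<close> of an isomorphic algebra
  \<open>B\<close>, where \<open>g\<close> is carried over to \<open>A\<close> by any isomorphism; the choice of the isomorphism only
  changes the result by a conjugation. For \<open>A = B\<close> it is conjugacy in the automorphism group.\<close>

definition conjugate_auts ::
    "('f::field, 'a::ab_group_add, 'y) alg_scheme \<Rightarrow> ('a \<Rightarrow> 'a) \<Rightarrow>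
     ('f, 'b::ab_group_add, 'z) alg_scheme \<Rightarrow> ('b \<Rightarrow> 'b) \<Rightarrow> bool" where
  "conjugate_auts A f B g \<longleftrightarrow> (\<exists>h. alg_iso A B h \<and> h \<circ> f = g \<circ> h)"


section \<open>The split Cayley algebra and Okubo algebras\<close>

text \<open>Indices of the canonical basis. Arithmetic in the type \<open>3\<close> is modulo 3.\<close>

datatype cayley_index = E1 | E2 | U 3 | V 3

instance cayley_index :: finite
proof
  have "x \<in> {E1, E2} \<union> range U \<union> range V" for x
    by (cases x) auto
  then have "(UNIV :: cayley_index set) \<subseteq> {E1, E2} \<union> range U \<union> range V"
    by blast
  then show "finite (UNIV :: cayley_index set)"
    by (rule finite_subset) simp
qed

definition cb :: "cayley_index \<Rightarrow> 'f::field ^ cayley_index" where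
  "cb b = axis b 1"

fun cb_mul :: "cayley_index \<Rightarrow> cayley_index \<Rightarrow> 'f::field ^ cayley_index" where
  "cb_mul E1 E1 = cb E1"
| "cb_mul E1 E2 = 0"
| "cb_mul E2 E1 = 0"
| "cb_mul E2 E2 = cb E2"
| "cb_mul E1 (U i) = cb (U i)"
| "cb_mul (U i) E2 = cb (U i)"
| "cb_mul E2 (V i) = cb (V i)"
| "cb_mul (V i) E1 = cb (V i)"
| "cb_mul E2 (U i) = 0"
| "cb_mul (U i) E1 = 0"
| "cb_mul E1 (V i) = 0"
| "cb_mul (V i) E2 = 0"
| "cb_mul (U i) (U j) =
     (if j = i + 1 then cb (V (i + 2)) else if i = j + 1 then - cb (V (j + 2)) else 0)"
| "cb_mul (V i) (V j) =
     (if j = i + 1 then cb (U (i + 2)) else if i = j + 1 then - cb (U (j + 2)) else 0)"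
| "cb_mul (U i) (V j) = (if i = j then - cb E1 else 0)"
| "cb_mul (V i) (U j) = (if i = j then - cb E2 else 0)"

text \<open>The norm is the one for which \<open>e1, e2\<close> and \<open>u_i, v_i\<close> are hyperbolic pairs, orthogonal to
  each other; it is the only norm making this product a Hurwitz algebra.\<close>

definition split_cayley :: "('f::field, 'f ^ cayley_index) unital_normed_alg" where
  "split_cayley =
     \<lparr>smul = (*s),
      mul = (\<lambda>x y. \<Sum>b\<in>UNIV. \<Sum>c\<in>UNIV. (x $ b * y $ c) *s cb_mul b c),
      nrm = (\<lambda>x. x $ E1 * x $ E2 + (\<Sum>i\<in>UNIV. x $ U i * x $ V i)),
      unity = cb E1 + cb E2\<rparr>"

fun st_shift :: "cayley_index \<Rightarrow> cayley_index" where
  "st_shift E1 = E1"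
| "st_shift E2 = E2"
| "st_shift (U i) = U (i + 1)"
| "st_shift (V i) = V (i + 1)"

definition tau_st :: "'f::field ^ cayley_index \<Rightarrow> 'f ^ cayley_index" where
  "tau_st x = (\<Sum>b\<in>UNIV. x $ b *s cb (st_shift b))"

definition split_okubo :: "('f::field, 'f ^ cayley_index) normed_alg" where
  "split_okubo = petersson split_cayley tau_st"

definition is_basis :: "('f::field \<Rightarrow> 'c::ab_group_add \<Rightarrow> 'c) \<Rightarrow> 'c set \<Rightarrow> bool" where
  "is_basis s T \<longleftrightarrow> \<not> Modules.module.dependent s T \<and> Modules.module.span s T = UNIV"

text \<open>For a field homomorphism \<open>\<iota>\<close>, the algebra \<open>B\<close> over the larger field is the scalar extension
  of \<open>A\<close>, with \<open>j\<close> being the map \<open>x \<mapsto> 1 \<otimes> x\<close>. The condition on bases says that the induced map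
  from the tensor product to \<open>B\<close> is bijective.\<close>

definition scalar_extension ::
    "('f::field \<Rightarrow> 'l::field) \<Rightarrow> ('f, 'a::ab_group_add, 'y) alg_scheme \<Rightarrow>
     ('l, 'b::ab_group_add, 'z) alg_scheme \<Rightarrow> ('a \<Rightarrow> 'b) \<Rightarrow> bool" where
  "scalar_extension \<iota> A B j \<longleftrightarrow>
     vector_space (smul A) \<and> vector_space (smul B) \<and>
     (\<forall>x y z. mul B (x + y) z = mul B x z + mul B y z \<and> mul B z (x + y) = mul B z x + mul B z y) \<and>
     (\<forall>c x y. mul B (smul B c x) y = smul B c (mul B x y) \<and>
        mul B x (smul B c y) = smul B c (mul B x y)) \<and>
     (\<forall>x y. j (x + y) = j x + j y) \<and>
     (\<forall>c x. j (smul A c x) = smul B (\<iota> c) (j x)) \<and>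
     (\<forall>x y. j (mul A x y) = mul B (j x) (j y)) \<and>
     (\<forall>T. is_basis (smul A) T \<longrightarrow> inj_on j T \<and> is_basis (smul B) (j ` T))"

text \<open>The extension of scalars is to an algebraic closure: a finite-dimensional algebra that
  becomes isomorphic to the split Okubo algebra over some extension field does so over the
  algebraic closure.\<close>

definition okubo_algebra :: "('f::field, 'c::ab_group_add, 'z) alg_scheme \<Rightarrow> bool" where
  "okubo_algebra A \<longleftrightarrow>
     (\<exists>(B :: ('f alg_closure, 'f alg_closure ^ cayley_index) alg) j g.
        scalar_extension to_ac A B j \<and> alg_iso B split_okubo g)"


section \<open>The Cayley algebra \<open>K \<oplus> W\<close> and its automorphism\<close>

text \<open>The free module \<open>W\<close> is \<open>'k ^ 3\<close>, and \<open>w_i\<close> is \<open>axis i (unity K)\<close>; the index \<open>3\<close> is \<open>0\<close>.\<close>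

definition sigma_form ::
    "('f::field, 'k::ab_group_add) unital_normed_alg \<Rightarrow> 'k ^ 3 \<Rightarrow> 'k ^ 3 \<Rightarrow> 'k" where
  "sigma_form K x y =
     (\<Sum>i\<in>UNIV. \<Sum>j\<in>UNIV.
        mul K (mul K (x $ i) (hconj K (y $ j))) (if i = j then 0 else - unity K))"

text \<open>\<open>a\<close> times the determinant of the coordinates.\<close>

definition phi_form ::
    "('f::field, 'k::ab_group_add) unital_normed_alg \<Rightarrow> 'k \<Rightarrow> 'k ^ 3 \<Rightarrow> 'k ^ 3 \<Rightarrow> 'k ^ 3 \<Rightarrow> 'k" where
  "phi_form K a x y z =
     mul K a (\<Sum>i\<in>UNIV. mul K (x $ i) (mul K (y $ (i + 1)) (z $ (i + 2)))
                       - mul K (x $ i) (mul K (y $ (i + 2)) (z $ (i + 1))))"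

definition cross_prod ::
    "('f::field, 'k::ab_group_add) unital_normed_alg \<Rightarrow> 'k \<Rightarrow> 'k ^ 3 \<Rightarrow> 'k ^ 3 \<Rightarrow> 'k ^ 3" where
  "cross_prod K a x y = (THE u. \<forall>z. sigma_form K z u = phi_form K a z x y)"

text \<open>In the norm, \<open>\<sigma>(x,x)\<close> is a scalar multiple of the unity of \<open>K\<close> and is read as that scalar.\<close>

definition KW_algebra ::
    "('f::field, 'k::ab_group_add) unital_normed_alg \<Rightarrow> 'k \<Rightarrow>
      ('f, 'k \<times> ('k ^ 3)) unital_normed_alg" where
  "KW_algebra K a =
     \<lparr>smul = (\<lambda>c (b, x). (smul K c b, \<chi> i. smul K c (x $ i))),
      mul = (\<lambda>(b, x) (c, y).
        (mul K b c - sigma_form K x y,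
         (\<chi> i. mul K b (y $ i)) + (\<chi> i. mul K (hconj K c) (x $ i)) + cross_prod K a x y)),
      nrm = (\<lambda>(b, x). nrm K b + (THE r. smul K r (unity K) = sigma_form K x x)),
      unity = (unity K, 0)\<rparr>"

text \<open>\<open>w_i\<close> is mapped to \<open>w_{i+1}\<close>. The underlying map of \<open>\<tau>_{K,a}\<close> does not depend on \<open>a\<close>; the
  algebra on which it acts does.\<close>

definition tau_KW :: "'k \<times> ('k ^ 3) \<Rightarrow> 'k \<times> ('k ^ 3)" where
  "tau_KW = (\<lambda>(b, x). (b, \<chi> i. x $ (i - 1)))"

end

theory Submission
  imports Defs
begin

text \<open>Write the fixed etale subalgebra as \<open>S = F1 + Fj\<close> and let \<open>W\<close> be its orthogonal complement.
  As \<open>(\<tau> - 1)\<^sup>2 = 1 + \<tau> + \<tau>\<^sup>2\<close> in characteristic 3, the form \<open>N(x + \<tau>x + \<tau>\<^sup>2x, y)\<close> on \<open>W\<close> is symmetric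
  and nonzero, so some \<open>x\<close> in \<open>W\<close> has \<open>n(x) + N(\<tau>x, x) \<noteq> 0\<close>. Adding multiples of \<open>x + \<tau>x + \<tau>\<^sup>2x\<close> and
  of \<open>j(\<tau>x - x)\<close> turns \<open>x\<close> into an isotropic \<open>w\<close> for which \<open>\<sigma>(\<tau>w, w) = -\<epsilon>\<close> is a scalar. Then
  \<open>w, \<tau>w, \<tau>\<^sup>2w\<close> is an \<open>S\<close>-basis of \<open>W\<close>, and \<open>n(\<tau>w \<cdot> \<tau>\<^sup>2w) = 0\<close> exhibits \<open>\<epsilon>\<close> as a norm from \<open>S\<close>; after
  rescaling, \<open>\<epsilon> = 1\<close> and the multiplication table is that of \<open>K \<oplus> W\<close>. Over the algebraic closure
  \<open>j\<close> becomes a multiple of \<open>e\<^sub>1 - e\<^sub>2\<close> and \<open>a\<close> becomes a cube, which gives an explicit embedding into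
  the split Cayley algebra carrying \<open>\<tau>\<close> to \<open>\<tau>\<^sub>s\<^sub>t\<close>.

  For the classification let \<open>s\<close> be the sum of the three coordinates in \<open>W\<close>. An isomorphism \<open>h\<close>
  commuting with the automorphisms induces \<open>\<phi>\<close> on \<open>K\<close> (modulo the radical of the fixed algebra) and
  satisfies \<open>s(h(x)) = \<phi>(s(x)) c\<close> for a unit \<open>c\<close>, because \<open>1 + \<tau> + \<tau>\<^sup>2\<close> only sees \<open>s\<close>. Since
  \<open>s(x \<times> \<tau>x)\<close> is the conjugate of \<open>a s(x)\<^sup>2\<close> in characteristic 3, comparing it for \<open>w\<^sub>1\<close> and
  \<open>h(w\<^sub>1)\<close> gives \<open>\<phi>(a) = c\<^sup>3 a'\<close>.\<close>

section \<open>Hurwitz algebras\<close>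

locale hurwitz_alg =
  fixes C :: "('f::field, 'c::ab_group_add) unital_normed_alg"
  assumes hurwitz: "hurwitz_on C UNIV"
begin

abbreviation times (infixl "\<star>" 70) where "x \<star> y \<equiv> mul C x y"
abbreviation scal (infixr "\<diamondop>" 75) where "c \<diamondop> x \<equiv> smul C c x"
abbreviation N where "N \<equiv> polar (nrm C)"
abbreviation n where "n \<equiv> nrm C"
abbreviation e where "e \<equiv> unity C"
abbreviation cj where "cj \<equiv> hconj C"

sublocale vector_space "smul C"
  using hurwitz by (simp add: hurwitz_on_def)

lemma add_mul: "(x + y) \<star> z = x \<star> z + y \<star> z"
  and mul_add: "z \<star> (x + y) = z \<star> x + z \<star> y"
  and smul_mul: "(c \<diamondop> x) \<star> y = c \<diamondop> (x \<star> y)"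
  and mul_smul: "x \<star> (c \<diamondop> y) = c \<diamondop> (x \<star> y)"
  and unity_mul [simp]: "e \<star> x = x"
  and mul_unity [simp]: "x \<star> e = x"
  and nrm_smul: "n (c \<diamondop> x) = c\<^sup>2 * n x"
  and polar_add_left: "N (x + y) z = N x z + N y z"
  and polar_smul_left: "N (c \<diamondop> x) y = c * N x y"
  and nrm_mul: "n (x \<star> y) = n x * n y"
  using hurwitz by (simp_all add: hurwitz_on_def)

lemma polar_nondegenerate: "(\<And>y. N x y = 0) \<Longrightarrow> x = 0"
  using hurwitz by (auto simp: hurwitz_on_def)

lemma polar_sym: "N x y = N y x"
  by (simp add: polar_def add.commute)

lemma polar_add_right: "N z (x + y) = N z x + N z y"
  using polar_add_left polar_sym by metis

lemma polar_smul_right: "N x (c \<diamondop> y) = c * N x y"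
  using polar_smul_left polar_sym by metis

lemma polar_zero [simp]: "N 0 x = 0" "N x 0 = 0"
  using polar_smul_left[of 0 x x] polar_smul_right[of x 0 x] by simp_all

lemma polar_minus: "N (- x) y = - N x y" "N x (- y) = - N x y"
  using polar_smul_left[of "-1" x y] polar_smul_right[of x "-1" y] by simp_all

lemma polar_diff: "N (x - y) z = N x z - N y z" "N z (x - y) = N z x - N z y"
  using polar_add_left[of x "- y" z] polar_add_right[of z x "- y"] by (simp_all add: polar_minus)

lemma mul_zero [simp]: "0 \<star> x = 0" "x \<star> 0 = 0"
  using smul_mul[of 0 x x] mul_smul[of x 0 x] by simp_all

lemma mul_minus: "(- x) \<star> y = - (x \<star> y)" "x \<star> (- y) = - (x \<star> y)"
  using smul_mul[of "-1" x y] mul_smul[of x "-1" y] by simp_all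

lemma diff_mul: "(x - y) \<star> z = x \<star> z - y \<star> z" and mul_diff: "z \<star> (x - y) = z \<star> x - z \<star> y"
  using add_mul[of x "- y" z] mul_add[of z x "- y"] by (simp_all add: mul_minus)

lemma nrm_add: "n (x + y) = n x + n y + N x y"
  by (simp add: polar_def)

lemma nrm_zero [simp]: "n 0 = 0"
  using nrm_smul[of 0 0] by simp

lemma nrm_minus: "n (- x) = n x"
  using nrm_smul[of "-1" x] by simp

lemma polar_self: "N x x = 2 * n x"
  using nrm_smul[of 2 x] scale_left_distrib[of 1 1 x] by (simp add: polar_def)

lemma polar_eqI: "(\<And>z. N x z = N y z) \<Longrightarrow> x = y"
  using polar_nondegenerate[of "x - y"] by (simp add: polar_diff)

text \<open>Multiplicativity gives n(1) n(z) = n(z), and nondegeneracy supplies a \<open>z\<close>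
  of nonzero norm. \<open>hurwitz_on\<close> admits the zero algebra, where \<open>n e = 0\<close>;
  the assumption excludes it.\<close>

lemma nrm_unity_eq_1:
  assumes "e \<noteq> 0"
  shows "n e = 1"
proof -
  obtain y where "N e y \<noteq> 0"
    using polar_nondegenerate assms by blast
  then obtain z where "n z \<noteq> 0"
    by (metis polar_def diff_0_right)
  moreover have "n e * n z = n z"
    using nrm_mul[of e z] by simp
  ultimately show ?thesis by simp
qed

section \<open>Polarized composition law, adjoints and conjugation\<close>

lemma polar_mul_left_cancel: "N (x \<star> y) (x \<star> z) = n x * N y z"
  by (simp add: polar_def nrm_mul right_diff_distrib flip: mul_add)

lemma polar_mul_right_cancel: "N (y \<star> x) (z \<star> x) = N y z * n x"
  by (simp add: polar_def nrm_mul left_diff_distrib flip: add_mul)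

lemma polar_mul_linearized:
  "N (x \<star> y) (z \<star> w) + N (z \<star> y) (x \<star> w) = N x z * N y w"
  using polar_mul_left_cancel[of "x + z" y w]
  by (simp add: add_mul polar_add_left polar_add_right polar_mul_left_cancel nrm_add
      distrib_right add.commute)

text \<open>Put the unity for \<open>z\<close> in \<open>polar_mul_linearized\<close>; the trace
  term N(x,1) N(y,z) is what turns \<open>x\<close> into its conjugate.\<close>

lemma polar_mul_adjoint_left: "N (x \<star> y) z = N y (cj x \<star> z)"
  using polar_mul_linearized[of x y e z]
  by (simp add: hconj_def diff_mul smul_mul polar_diff polar_smul_right algebra_simps)

lemma polar_mul_adjoint_right: "N (y \<star> x) z = N y (z \<star> cj x)"
  using polar_mul_linearized[of y x z e]
  by (simp add: hconj_def mul_diff mul_smul polar_diff polar_smul_right polar_sym algebra_simps)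

lemma cj_add: "cj (x + y) = cj x + cj y"
  by (simp add: hconj_def polar_add_left scale_left_distrib)

lemma cj_smul: "cj (c \<diamondop> x) = c \<diamondop> cj x"
  by (simp add: hconj_def polar_smul_left scale_right_diff_distrib)

lemma cj_minus: "cj (- x) = - cj x"
  by (simp add: hconj_def polar_minus)

lemma cj_diff: "cj (x - y) = cj x - cj y"
  using cj_add[of x "- y"] by (simp add: cj_minus)

lemma cj_zero [simp]: "cj 0 = 0"
  by (simp add: hconj_def)

lemma cj_cj [simp]: "cj (cj x) = x"
proof (cases "e = 0")
  case True
  then show ?thesis by (simp add: hconj_def)
next
  case False
  then show ?thesis
    by (simp add: hconj_def polar_diff polar_smul_left polar_self nrm_unity_eq_1)
qed

lemma cj_unity [simp]: "cj e = e"
proof (cases "e = 0")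
  case False
  then have "cj e = (1 + 1) \<diamondop> e - e"
    by (simp add: hconj_def polar_self nrm_unity_eq_1)
  then show ?thesis
    by (simp only: scale_left_distrib) simp
qed (simp add: hconj_def)

text \<open>Left multiplication by \<open>cj x\<close> is adjoint to that by \<open>x\<close>, so
  pairing with any z gives N(xy, xz) = n(x) N(y,z). This and its mirror image stand in for
  associativity.\<close>

lemma cj_mul_mul: "cj x \<star> (x \<star> y) = n x \<diamondop> y"
  by (rule polar_eqI)
    (simp add: polar_mul_adjoint_left[of "cj x"] polar_mul_left_cancel polar_smul_left)

lemma mul_mul_cj: "(y \<star> x) \<star> cj x = n x \<diamondop> y"
  by (rule polar_eqI)
    (simp add: polar_mul_adjoint_right[of _ "cj x"] polar_mul_right_cancel polar_smul_left)

lemma cj_mul_mul_linearized: "cj x \<star> (y \<star> z) + cj y \<star> (x \<star> z) = N x y \<diamondop> z"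
  using cj_mul_mul[of "x + y" z]
  by (simp add: cj_add add_mul mul_add nrm_add scale_left_distrib cj_mul_mul add_ac)

lemma mul_mul_cj_linearized: "(z \<star> x) \<star> cj y + (z \<star> y) \<star> cj x = N x y \<diamondop> z"
  using mul_mul_cj[of z "x + y"]
  by (simp add: cj_add add_mul mul_add nrm_add scale_left_distrib mul_mul_cj add_ac)

lemma mul_cj: "x \<star> cj x = n x \<diamondop> e"
  using mul_mul_cj[of e x] by simp

lemma mul_self: "x \<star> x = N x e \<diamondop> x - n x \<diamondop> e"
  using mul_cj[of x] by (simp add: hconj_def mul_diff mul_smul algebra_simps)

lemma polar_cj: "N (cj x) y = N x (cj y)"
  by (simp add: hconj_def polar_diff polar_smul_left polar_smul_right polar_sym mult.commute)

lemma cj_mul: "cj (x \<star> y) = cj y \<star> cj x"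
proof (rule polar_eqI)
  fix z
  have "N (cj (x \<star> y)) z = N y (cj x \<star> cj z)"
    by (simp add: polar_cj polar_mul_adjoint_left)
  also have "\<dots> = N (cj x) (y \<star> z)"
    using polar_mul_adjoint_right[of y z "cj x"] by (simp add: polar_sym)
  also have "\<dots> = N (cj y \<star> cj x) z"
    by (simp add: polar_mul_adjoint_left)
  finally show "N (cj (x \<star> y)) z = N (cj y \<star> cj x) z" .
qed

section \<open>Moving factors past orthogonal vectors\<close>

lemma cj_eq_minus: "N u e = 0 \<Longrightarrow> cj u = - u"
  by (simp add: hconj_def)

text \<open>Orthogonality kills the right-hand side of the linearized identity and
  \<open>cj u\<close> is \<open>- u\<close>; what remains is a commutation rule that conjugates
  \<open>s\<close>. With \<open>s\<close> in F1 + Fj and vectors in W, this rule and the next two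
  give the multiplication table.\<close>

lemma mul_swap_left:
  assumes "N u e = 0" "N u s = 0"
  shows "u \<star> (s \<star> v) = cj s \<star> (u \<star> v)"
  using cj_mul_mul_linearized[of u s v] assms by (simp add: cj_eq_minus mul_minus)

lemma mul_cj_swap:
  assumes "N u e = 0" "N u s = 0"
  shows "u \<star> cj s = s \<star> u"
  using mul_mul_cj_linearized[of e u s] assms by (simp add: cj_eq_minus mul_minus)

lemma mul_mul_swap:
  assumes "N u e = 0" "N u s = 0" "N v e = 0" "N v s = 0"
  shows "(s \<star> u) \<star> v = (u \<star> v) \<star> s"
proof -
  have "N v (cj s) = 0"
    using assms by (simp add: hconj_def polar_diff polar_smul_right)
  then have "N (cj s) v = 0"
    by (simp add: polar_sym)
  then have "(u \<star> cj s) \<star> cj v + (u \<star> v) \<star> s = 0"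
    using mul_mul_cj_linearized[of u "cj s" v] by simp
  then show ?thesis
    using assms by (simp add: cj_eq_minus mul_minus mul_cj_swap eq_neg_iff_add_eq_0)
qed

lemma char3_add:
  assumes "CHAR('f) = 3"
  shows "x + x + (x :: 'c) = 0"
proof -
  have "(1 + 1 + 1 :: 'f) = of_nat 3" by simp
  then have "(1 + 1 + 1 :: 'f) = 0"
    by (metis assms of_nat_CHAR)
  then have "(1 + 1 + 1) \<diamondop> x = 0" by simp
  then show ?thesis by (simp only: scale_left_distrib scale_one)
qed

end

section \<open>Two-dimensional spaces and quadratic etale algebras\<close>

lemma (in vector_space) dim_2_subspace_generator:
  assumes S: "subspace S" "dim S = 2" and u: "u \<in> S" "u \<noteq> 0"
  obtains y where "y \<in> S" "y \<notin> span {u}" "\<And>x. x \<in> S \<Longrightarrow> \<exists>p q. x = scale p u + scale q y"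
proof -
  have "independent {u}"
    using u by simp
  then obtain B where B: "{u} \<subseteq> B" "B \<subseteq> S" "independent B" "S \<subseteq> span B"
    using maximal_independent_subset_extend[of "{u}" S] u by auto
  have "card B = 2"
    using basis_card_eq_dim[of B S] B S by simp
  then obtain y where y: "B = {u, y}" "u \<noteq> y"
    using B(1) by (metis card_2_iff insert_commute insert_iff insert_subset singletonD)
  have "y \<notin> span {u}"
    using B(3) y by (metis dependent_def insertCI insert_Diff_single insert_commute
        Diff_insert_absorb singletonD)
  moreover have "\<exists>p q. x = scale p u + scale q y" if "x \<in> S" for x
  proof -
    from that B(4) y have "x \<in> span {u, y}" by auto
    then obtain p where "x - scale p u \<in> span {y}"
      by (auto simp: span_breakdown_eq)
    then obtain q where "x - scale p u = scale q y"
      by (auto simp: span_singleton)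
    then show ?thesis by (metis add.commute diff_add_cancel)
  qed
  ultimately show ?thesis using that B y by blast
qed

locale etale_alg = hurwitz_alg +
  assumes dim_UNIV: "dim UNIV = 2"
begin

lemma unity_neq_0: "e \<noteq> 0"
proof
  assume "e = 0"
  then have "x = 0" for x :: 'b
    using unity_mul[of x] by simp
  then have "(UNIV :: 'b set) = {0}" by blast
  then have "dim (UNIV :: 'b set) = dim ({} :: 'b set)"
    by (metis dim_span span_empty)
  moreover have "dim ({} :: 'b set) = 0"
    using dim_eq_card_independent[of "{}"] independent_empty by simp
  ultimately show False using dim_UNIV by simp
qed

lemma nrm_unity: "n e = 1"
  by (simp add: nrm_unity_eq_1 unity_neq_0)

lemma generator: obtains y where "\<And>x. \<exists>p q. x = p \<diamondop> e + q \<diamondop> y"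
  by (rule dim_2_subspace_generator[OF subspace_UNIV dim_UNIV UNIV_I unity_neq_0]) auto

lemma mul_commute: "x \<star> y = y \<star> x"
proof -
  obtain g where "\<And>x. \<exists>p q. x = p \<diamondop> e + q \<diamondop> g" using generator by blast
  then obtain p q p' q' where "x = p \<diamondop> e + q \<diamondop> g" "y = p' \<diamondop> e + q' \<diamondop> g" by metis
  then show ?thesis
    by (simp add: add_mul mul_add smul_mul mul_smul mult.commute add_ac scale_right_distrib)
qed

text \<open>As 1 and one element \<open>g\<close> span the algebra, only (gg)g = g(gg) has to be
  checked, an instance of commutativity.\<close>

lemma mul_assoc: "(x \<star> y) \<star> z = x \<star> (y \<star> z)"
proof -
  obtain g where g: "\<And>x. \<exists>p q. x = p \<diamondop> e + q \<diamondop> g" using generator by blast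
  have *: "(g \<star> g) \<star> g = g \<star> (g \<star> g)" by (rule mul_commute)
  from g obtain p q p' q' p'' q'' where
    "x = p \<diamondop> e + q \<diamondop> g" "y = p' \<diamondop> e + q' \<diamondop> g" "z = p'' \<diamondop> e + q'' \<diamondop> g" by metis
  then show ?thesis
    by (simp add: add_mul mul_add smul_mul mul_smul mult_ac add_ac scale_right_distrib *)
qed

lemma mul_left_commute: "x \<star> (y \<star> z) = y \<star> (x \<star> z)"
  by (metis mul_assoc mul_commute)

lemmas mul_ac = mul_assoc mul_commute mul_left_commute

lemma cj_mul': "cj (x \<star> y) = cj x \<star> cj y"
  by (simp add: cj_mul mul_commute)

lemma nrm_1_cancel: "n b = 1 \<Longrightarrow> b \<star> cj b = e"
  by (simp add: mul_cj)

end

lemma quadratic_etale_iff: "quadratic_etale K \<longleftrightarrow> etale_alg K"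
  by (auto simp: quadratic_etale_on_def etale_alg_def etale_alg_axioms_def hurwitz_alg_def)

section \<open>Conjugacy of the automorphisms of \<open>K \<oplus> W\<close>\<close>

lemma three_eq_0: "(3::3) = 0" by simp

lemma numeral_3_simps [simp]: "(3::3) = 0" "(4::3) = 1" "- (1::3) = 2" "- (2::3) = 1"
  by simp_all

lemma sum_3': "(\<Sum>i\<in>UNIV. f (i::3)) = f 0 + f 1 + f 2" for f :: "3 \<Rightarrow> 'a::comm_monoid_add"
  unfolding sum_3 three_eq_0 by (rule trans[OF add.commute add.assoc[symmetric]])

lemma all_3: "(\<forall>i::3. P i) \<longleftrightarrow> P 0 \<and> P 1 \<and> P 2"
  unfolding forall_3 three_eq_0 by iprover

lemma vec_3_eq_iff: "(x :: 'a ^ 3) = y \<longleftrightarrow> x $ 0 = y $ 0 \<and> x $ 1 = y $ 1 \<and> x $ 2 = y $ 2"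
  by (simp add: vec_eq_iff all_3)

text \<open>The form s of the classification; in characteristic 3 it is \<sigma>(x, w_1 + w_2 +
  w_3).\<close>

definition csum :: "'k::ab_group_add ^ 3 \<Rightarrow> 'k" where
  "csum x = x $ 0 + x $ 1 + x $ 2"

section \<open>The algebra K + W in characteristic 3\<close>

locale KW = etale_alg C for C :: "('f::field, 'k::ab_group_add) unital_normed_alg" +
  assumes char3: "CHAR('f) = 3"
begin

text \<open>A normal form for characteristic 3: \<open>minus_eq\<close> and \<open>diff_eq\<close>
  turn signs into doubled summands, \<open>add_ac\<close> brings equal summands together, and this
  rule and the next delete triples.\<close>

lemma add_add_self [simp]: "x + (x + x) = 0" for x :: 'k
  using char3_add[OF char3, of x] by (simp add: add.assoc)

lemma add_add_self' [simp]: "x + (x + (x + y)) = y" for x :: 'k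
  using add_add_self[of x] by (simp only: add.assoc[symmetric] add_0)

lemma minus_eq: "- x = x + x" for x :: 'k
  by (simp add: neg_eq_iff_add_eq_0)

lemma diff_eq: "x - y = x + (y + y)" for x y :: 'k
  by (simp only: diff_conv_add_uminus minus_eq)

text \<open>The cofactors along z of the determinant in \<Phi>(z, x, y).\<close>

definition minor :: "'k ^ 3 \<Rightarrow> 'k ^ 3 \<Rightarrow> 'k ^ 3" where
  "minor x y = (\<chi> i. x $ (i + 1) \<star> y $ (i + 2) - x $ (i + 2) \<star> y $ (i + 1))"

lemma sigma_form_eq:
  "sigma_form C x y = - (x $ 0 \<star> cj (y $ 1 + y $ 2) + x $ 1 \<star> cj (y $ 0 + y $ 2)
     + x $ 2 \<star> cj (y $ 0 + y $ 1))"
  by (simp add: sigma_form_def sum_3' cj_add mul_add mul_minus)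

lemma phi_form_eq:
  "phi_form C a z x y =
     a \<star> (z $ 0 \<star> minor x y $ 0 + z $ 1 \<star> minor x y $ 1 + z $ 2 \<star> minor x y $ 2)"
  by (simp add: phi_form_def sum_3' minor_def mul_diff)

text \<open>With M the all-ones matrix, \<sigma> has Gram matrix I - M, and M^2 = 3M = 0 makes I + M
  its inverse. Hence adding the coordinate sum solves the defining system.\<close>

lemma cross_prod_eq:
  "cross_prod C a x y = (\<chi> i. cj (a \<star> (minor x y $ i + csum (minor x y))))"
  (is "_ = ?u")
  unfolding cross_prod_def
proof (rule the_equality)
  have "cj (?u $ 1 + ?u $ 2) = - (a \<star> minor x y $ 0)"
    "cj (?u $ 0 + ?u $ 2) = - (a \<star> minor x y $ 1)"
    "cj (?u $ 0 + ?u $ 1) = - (a \<star> minor x y $ 2)"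
    by (simp_all add: csum_def cj_add mul_add eq_neg_iff_add_eq_0 add_ac)
  then show "\<forall>z. sigma_form C z ?u = phi_form C a z x y"
    unfolding sigma_form_eq phi_form_eq
    by (simp add: mul_minus mul_add mul_left_commute)
next
  fix u
  assume u: "\<forall>z. sigma_form C z u = phi_form C a z x y"
  \<comment> \<open>Pairing with the three basis vectors already determines
    \<open>u\<close>.\<close>
  have "- cj (u $ 1 + u $ 2) = a \<star> minor x y $ 0"
    using u[rule_format, of "axis 0 e"] by (simp add: sigma_form_eq phi_form_eq axis_def)
  moreover have "- cj (u $ 0 + u $ 2) = a \<star> minor x y $ 1"
    using u[rule_format, of "axis 1 e"] by (simp add: sigma_form_eq phi_form_eq axis_def)
  moreover have "- cj (u $ 0 + u $ 1) = a \<star> minor x y $ 2"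
    using u[rule_format, of "axis 2 e"] by (simp add: sigma_form_eq phi_form_eq axis_def)
  ultimately have "a \<star> minor x y $ 0 = cj (u $ 1) + cj (u $ 1) + (cj (u $ 2) + cj (u $ 2))"
    "a \<star> minor x y $ 1 = cj (u $ 0) + cj (u $ 0) + (cj (u $ 2) + cj (u $ 2))"
    "a \<star> minor x y $ 2 = cj (u $ 0) + cj (u $ 0) + (cj (u $ 1) + cj (u $ 1))"
    by (simp_all only: minus_eq cj_add add_ac)
  then show "u = ?u"
    by (simp add: vec_3_eq_iff csum_def mul_add cj_add add_ac)
qed

text \<open>The correction term in \<open>cross_prod_eq\<close> is the same in all three
  coordinates, so it adds up to zero.\<close>

lemma csum_cross_prod: "csum (cross_prod C a x y) = cj (a \<star> csum (minor x y))"
  by (simp add: cross_prod_eq csum_def mul_add cj_add add_ac)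

text \<open>The minors add up to the sum of all x_i^2 - x_i x_(i+1), which differs from the square
  of the coordinate sum by a multiple of 3.\<close>

lemma csum_minor_shift: "csum (minor x (\<chi> i. x $ (i - 1))) = csum x \<star> csum x"
  by (simp add: csum_def minor_def mul_add add_mul diff_eq mul_commute add_ac)

lemma minor_self: "minor x x = 0"
  by (simp add: minor_def vec_eq_iff mul_commute)

lemma cross_prod_self: "cross_prod C a x x = 0"
  by (simp add: cross_prod_eq minor_self csum_def vec_eq_iff)

lemma mul_KW:
  "mul (KW_algebra C a) (b, x) (c, y) =
     (b \<star> c - sigma_form C x y, (\<chi> i. b \<star> y $ i + cj c \<star> x $ i) + cross_prod C a x y)"
  by (simp add: KW_algebra_def vec_eq_iff)

lemma smul_KW: "smul (KW_algebra C a) r (b, x) = (r \<diamondop> b, \<chi> i. r \<diamondop> x $ i)"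
  by (simp add: KW_algebra_def)

lemma vector_space_KW: "vector_space (smul (KW_algebra C a))"
  by unfold_locales
    (auto simp: KW_algebra_def vec_eq_iff algebra_simps)

definition const :: "'k \<Rightarrow> 'k ^ 3" where
  "const z = (\<chi> i. z)"

lemma const_nth [simp]: "const z $ i = z"
  by (simp add: const_def)

lemma tau_KW_eq: "tau_KW (b, x) = (b, \<chi> i. x $ (i - 1))"
  by (simp add: tau_KW_def)

text \<open>The K-component is fixed, hence tripled to zero. Any isomorphism compatible with the two
  shifts respects this operator, which is how coordinate sums are carried across.\<close>

lemma tau_KW_trace: "tau_KW (tau_KW t) + tau_KW t + t = (0, const (csum (snd t)))"
  by (cases t) (simp add: tau_KW_eq vec_3_eq_iff csum_def add_ac)

lemma tau_KW_fixed_iff: "tau_KW t = t \<longleftrightarrow> (\<exists>z. snd t = const z)"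
  by (cases t) (auto simp: tau_KW_eq vec_3_eq_iff)

text \<open>On constant vectors \<sigma> has six equal terms and the minors cancel. So the constants
  form a square-zero ideal of the fixed algebra, and taking the K-component is multiplicative
  there.\<close>

lemma mul_KW_const:
  "mul (KW_algebra C a) (b, const x) (c, const y) = (b \<star> c, const (b \<star> y + cj c \<star> x))"
  by (simp add: mul_KW sigma_form_eq cross_prod_eq minor_def vec_3_eq_iff cj_add mul_add
      csum_def mul_commute add_ac)

end


section \<open>Isomorphisms preserve unity, trace and norm\<close>

lemma alg_iso_unity:
  assumes "hurwitz_alg A" "hurwitz_alg B" "alg_iso A B f"
  shows "f (unity A) = unity B"
proof -
  interpret A: hurwitz_alg A by fact
  interpret B: hurwitz_alg B by fact
  obtain x where "f x = unity B"
    using assms(3) unfolding alg_iso_def by (metis bij_pointE)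
  then have "f (unity A) = mul B (f (unity A)) (f x)" by simp
  also have "\<dots> = f (mul A (unity A) x)"
    using assms(3) unfolding alg_iso_def by metis
  finally show ?thesis using \<open>f x = unity B\<close> by simp
qed

lemma alg_iso_add: "alg_iso A B f \<Longrightarrow> f (x + y) = f x + f y"
  and alg_iso_smul: "alg_iso A B f \<Longrightarrow> f (smul A c x) = smul B c (f x)"
  and alg_iso_mul: "alg_iso A B f \<Longrightarrow> f (mul A x y) = mul B (f x) (f y)"
  and alg_iso_zero: "alg_iso A B f \<Longrightarrow> f 0 = 0"
  and alg_iso_diff: "alg_iso A B f \<Longrightarrow> f (x - y) = f x - f y"
  and alg_iso_minus: "alg_iso A B f \<Longrightarrow> f (- x) = - f x"
proof -
  assume f: "alg_iso A B f"
  then interpret Vector_Spaces.linear "smul A" "smul B" f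
    by (simp add: alg_iso_def)
  show "f (x + y) = f x + f y" "f (smul A c x) = smul B c (f x)" "f 0 = 0"
    "f (x - y) = f x - f y" "f (- x) = - f x"
    by (rule add scale zero diff neg)+
  show "f (mul A x y) = mul B (f x) (f y)"
    using f by (simp add: alg_iso_def)
qed

text \<open>\<open>alg_iso\<close> does not mention norms. They are preserved because
  \<open>f\<close> carries the quadratic equation of \<open>x\<close> to that of \<open>f x\<close>,
  whose coefficients are determined unless \<open>f x\<close> is a multiple of the unity; in that
  case the traces are compared directly.\<close>

lemma alg_iso_trace_nrm:
  assumes "hurwitz_alg A" "hurwitz_alg B" "alg_iso A B f" "unity A \<noteq> 0"
  shows "polar (nrm B) (f x) (unity B) = polar (nrm A) x (unity A) \<and> nrm B (f x) = nrm A x"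
proof -
  interpret A: hurwitz_alg A by fact
  interpret B: hurwitz_alg B by fact
  note f = alg_iso_unity[OF assms(1-3)] assms(3)[THEN alg_iso_mul] assms(3)[THEN alg_iso_smul]
    assms(3)[THEN alg_iso_diff]
  have "inj f" using assms(3) by (simp add: alg_iso_def bij_is_inj)
  then have ne: "unity B \<noteq> 0"
    using assms(3,4) f(1) by (metis alg_iso_zero injD)
  let ?t = "polar (nrm A) x (unity A)" and ?t' = "polar (nrm B) (f x) (unity B)"
  let ?m = "nrm A x" and ?m' = "nrm B (f x)"
  have "smul B ?t (f x) - smul B ?m (unity B) = f (mul A x x)"
    by (simp add: A.mul_self f)
  also have "\<dots> = smul B ?t' (f x) - smul B ?m' (unity B)"
    by (simp add: f B.mul_self)
  finally have *: "smul B (?t - ?t') (f x) = smul B (?m - ?m') (unity B)"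
    by (simp add: B.scale_left_diff_distrib algebra_simps)
  have t: "?t = ?t'"
  proof (rule ccontr)
    assume "?t \<noteq> ?t'"
    then have "f x = smul B (inverse (?t - ?t')) (smul B (?t - ?t') (f x))"
      by simp
    also have "\<dots> = smul B ((?m - ?m') / (?t - ?t')) (unity B)"
      unfolding * by (simp add: divide_inverse mult.commute)
    finally obtain r where r: "f x = smul B r (unity B)" by blast
    also have "\<dots> = f (smul A r (unity A))"
      by (simp add: f)
    finally have "x = smul A r (unity A)"
      using \<open>inj f\<close> by (simp add: injD)
    with r have "?t = ?t'"
      by (simp add: A.polar_smul_left B.polar_smul_left A.polar_self B.polar_self
          A.nrm_unity_eq_1 B.nrm_unity_eq_1 ne assms(4))
    with \<open>?t \<noteq> ?t'\<close> show False ..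
  qed
  with * ne show ?thesis by simp
qed

section \<open>Comparing two algebras K + W\<close>

locale KW_pair = K: KW K + K': KW K'
  for K :: "('f::field, 'k::ab_group_add) unital_normed_alg"
    and K' :: "('f, 'l::ab_group_add) unital_normed_alg"
begin

lemma
  assumes "alg_iso K K' \<phi>"
  shows nrm_alg_iso: "nrm K' (\<phi> x) = nrm K x"
    and hconj_alg_iso: "\<phi> (hconj K x) = hconj K' (\<phi> x)"
  using alg_iso_trace_nrm[OF K.hurwitz_alg_axioms K'.hurwitz_alg_axioms assms K.unity_neq_0, of x]
    alg_iso_unity[OF K.hurwitz_alg_axioms K'.hurwitz_alg_axioms assms]
  by (simp_all add: hconj_def alg_iso_diff[OF assms] alg_iso_smul[OF assms])

text \<open>The norm r of \<open>b'\<close> satisfies (r - 1)^3 = r^3 - 1 = 0 in characteristic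
  3.\<close>

lemma nrm_cube_root_eq_1:
  assumes "alg_iso K K' \<phi>" "nrm K a = 1" "nrm K' a' = 1"
    and "\<phi> a = mul K' (mul K' (mul K' b' b') b') a'"
  shows "nrm K' b' = 1"
proof -
  let ?r = "nrm K' b'"
  have three: "(3::'f) = 0"
    using of_nat_CHAR[where 'a = 'f] K.char3 by simp
  have "?r ^ 3 = nrm K' (\<phi> a)"
    by (simp add: assms(3,4) K'.nrm_mul power3_eq_cube)
  then have "?r ^ 3 = 1" using assms(2) by (simp only: nrm_alg_iso[OF assms(1)])
  moreover have "(?r - 1) ^ 3 = ?r ^ 3 - 1 - 3 * (?r ^ 2 - ?r)"
    by (simp add: algebra_simps power2_eq_square power3_eq_cube)
  ultimately have "(?r - 1) ^ 3 = 0"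
    by (simp add: three)
  then show ?thesis by simp
qed

lemma conjugate_if_cube:
  assumes \<phi>: "alg_iso K K' \<phi>" and "nrm K a = 1" "nrm K' a' = 1"
    and a: "\<phi> a = mul K' (mul K' (mul K' b b) b) a'"
  shows "conjugate_auts (KW_algebra K a) tau_KW (KW_algebra K' a') tau_KW"
proof -
  note \<phi>s = alg_iso_add[OF \<phi>] alg_iso_smul[OF \<phi>] alg_iso_mul[OF \<phi>] alg_iso_zero[OF \<phi>]
    alg_iso_diff[OF \<phi>] alg_iso_minus[OF \<phi>] hconj_alg_iso[OF \<phi>]
  have nb: "nrm K' b = 1"
    using assms by (rule nrm_cube_root_eq_1)
  have bb: "mul K' b (mul K' (hconj K' b) x) = x" "mul K' (hconj K' b) (mul K' b x) = x" for x
    using K'.nrm_1_cancel[OF nb] by (metis K'.mul_assoc K'.mul_commute K'.unity_mul)+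
  have bb': "mul K' b (mul K' u (mul K' (hconj K' b) x)) = mul K' u x" for u x
    by (metis bb(1) K'.mul_left_commute)
  \<comment> \<open>Scaling W by \<open>b\<close> preserves \<sigma>, as \<open>b\<close> has norm
    1, and multiplies determinants by b^3, which accounts for the passage from \<open>a'\<close> to
    \<open>\<phi> a\<close>.\<close>
  define h where "h = (\<lambda>(c, x :: 'k ^ 3). (\<phi> c, \<chi> i. mul K' b (\<phi> (x $ i))))"
  have h: "h (c, x) = (\<phi> c, \<chi> i. mul K' b (\<phi> (x $ i)))" for c x
    by (simp add: h_def)
  obtain \<psi> where \<psi>: "\<And>x. \<psi> (\<phi> x) = x" "\<And>x. \<phi> (\<psi> x) = x"
    using \<phi> unfolding alg_iso_def by (metis bij_inv_eq_iff)
  have "Vector_Spaces.linear (smul (KW_algebra K a)) (smul (KW_algebra K' a')) h"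
    unfolding Vector_Spaces.linear_def module_hom_def module_hom_axioms_def
    using K.vector_space_KW[of a] K'.vector_space_KW[of a']
    by (auto simp: module_iff_vector_space h K.smul_KW K'.smul_KW \<phi>s K'.mul_smul K'.mul_add
        vec_eq_iff)
  moreover have "bij h"
    by (rule o_bij[of "\<lambda>(c, x). (\<psi> c, \<chi> i. \<psi> (mul K' (hconj K' b) (x $ i)))"])
      (auto simp: fun_eq_iff h \<psi> bb)
  moreover have "h (mul (KW_algebra K a) (c, x) (d, y)) = mul (KW_algebra K' a') (h (c, x)) (h (d, y))"
    for c x d y
  proof -
    let ?x = "\<chi> i. mul K' b (\<phi> (x $ i))" and ?y = "\<chi> i. mul K' b (\<phi> (y $ i))"
    have "\<phi> (sigma_form K x y) = sigma_form K' ?x ?y"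
      unfolding K.sigma_form_eq K'.sigma_form_eq
      by (simp add: \<phi>s K'.cj_add K'.cj_mul' K'.mul_add K'.mul_ac bb bb')
    moreover have "K'.minor ?x ?y $ i = mul K' b (mul K' b (\<phi> (K.minor x y $ i)))" for i
      by (simp add: K.minor_def K'.minor_def \<phi>s K'.mul_diff K'.mul_ac)
    then have "cross_prod K' a' ?x ?y = (\<chi> i. mul K' b (\<phi> (cross_prod K a x y $ i)))"
      by (simp add: K.cross_prod_eq K'.cross_prod_eq \<phi>s csum_def K'.cj_mul' K'.cj_add a
          K'.mul_add K'.mul_ac bb bb' vec_eq_iff)
    ultimately show ?thesis
      by (simp add: h K.mul_KW K'.mul_KW \<phi>s K'.mul_add K'.mul_ac vec_eq_iff)
  qed
  moreover have "h \<circ> tau_KW = tau_KW \<circ> h"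
    by (auto simp: fun_eq_iff h tau_KW_def vec_eq_iff)
  ultimately show ?thesis
    unfolding conjugate_auts_def alg_iso_def by (intro exI[of _ h]) auto
qed

lemma cube_if_conjugate:
  assumes "conjugate_auts (KW_algebra K a) tau_KW (KW_algebra K' a') tau_KW"
    and na: "nrm K a = 1" "nrm K' a' = 1"
  obtains \<phi> c where "alg_iso K K' \<phi>" "\<phi> a = mul K' (mul K' (mul K' c c) c) a'"
proof -
  let ?A = "KW_algebra K a" and ?B = "KW_algebra K' a'"
  obtain h where h: "alg_iso ?A ?B h" and "h \<circ> tau_KW = tau_KW \<circ> h"
    using assms(1) unfolding conjugate_auts_def by blast
  then have tau: "h (tau_KW t) = tau_KW (h t)" for t
    by (metis comp_apply)
  note hs = alg_iso_add[OF h] alg_iso_smul[OF h] alg_iso_mul[OF h] alg_iso_zero[OF h]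
  have "bij h" using h by (simp add: alg_iso_def)
  have trace: "h (0, K.const (csum (snd t))) = (0, K'.const (csum (snd (h t))))" for t
    unfolding K.tau_KW_trace[symmetric] K'.tau_KW_trace[symmetric] by (simp add: hs tau)
  \<comment> \<open>\<open>h\<close> need not map K to K. It respects the fixed algebras, so the
    image of b may have a constant W-component, which \<open>\<phi>\<close> discards.\<close>
  define \<phi> where "\<phi> b = fst (h (b, 0))" for b
  define c where "c = csum (snd (h (0, axis 0 (unity K))))"
  have h_const0: "h (0, K.const (unity K)) = (0, K'.const c)"
    using trace[of "(0, axis 0 (unity K))"] by (simp add: c_def csum_def axis_def)
  have "\<exists>z. h (b, 0) = (\<phi> b, K'.const z)" for b
  proof -
    have "tau_KW (h (b, 0)) = h (b, 0)"
      by (simp add: K.tau_KW_eq zero_vec_def flip: tau)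
    then show ?thesis
      unfolding K'.tau_KW_fixed_iff \<phi>_def by (metis prod.collapse)
  qed
  then obtain \<eta> where h_K: "\<And>b. h (b, 0) = (\<phi> b, K'.const (\<eta> b))" by metis
  have const0: "K.const 0 = 0" by (simp add: vec_eq_iff)
  have h_const: "h (0, K.const b) = (0, K'.const (mul K' (\<phi> b) c))" for b
  proof -
    have "(0, K.const b) = mul ?A (b, 0) (0, K.const (unity K))"
      using K.mul_KW_const[of a b 0 0 "unity K"] by (simp add: const0)
    then show ?thesis
      by (simp add: hs h_K h_const0 K'.mul_KW_const)
  qed
  have csum_h: "csum (snd (h (b, x))) = mul K' (\<phi> (csum x)) c" for b x
  proof -
    have "K'.const (csum (snd (h (b, x)))) = K'.const (mul K' (\<phi> (csum x)) c)"
      using trace[of "(b, x)"] by (simp add: h_const)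
    then show ?thesis by (simp add: vec_eq_iff)
  qed
  have \<phi>: "alg_iso K K' \<phi>"
    unfolding alg_iso_def
  proof (intro conjI allI)
    show "Vector_Spaces.linear (smul K) (smul K') \<phi>"
    proof unfold_locales
      show "\<phi> (x + y) = \<phi> x + \<phi> y" for x y
        using hs(1)[of "(x, 0)" "(y, 0)"] by (simp add: h_K)
      show "\<phi> (smul K r x) = smul K' r (\<phi> x)" for r x
      proof -
        have "(smul K r x, 0) = smul ?A r (x, 0)"
          by (simp add: K.smul_KW vec_eq_iff)
        then show ?thesis
          unfolding \<phi>_def by (simp add: hs h_K K'.smul_KW)
      qed
    qed
    show mul: "\<phi> (mul K x y) = mul K' (\<phi> x) (\<phi> y)" for x y
    proof -
      have "(mul K x y, 0) = mul ?A (x, 0) (y, 0)"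
        using K.mul_KW_const[of a x 0 y 0] by (simp add: const0)
      then show ?thesis
        unfolding \<phi>_def by (simp add: hs h_K K'.mul_KW_const)
    qed
    show "bij \<phi>"
    proof (rule bijI)
      show "inj \<phi>"
      proof (rule injI)
        fix x y assume "\<phi> x = \<phi> y"
        then have "h (x - y, 0) = (0, K'.const (\<eta> x - \<eta> y))"
          using alg_iso_diff[OF h, of "(x, 0)" "(y, 0)"] by (simp add: h_K vec_eq_iff)
        \<comment> \<open>A constant vector is the trace of a vector with one nonzero coordinate,
          hence the image of a constant vector; and K meets the constants in 0.\<close>
        moreover obtain t where "h t = (0, axis 0 (\<eta> x - \<eta> y))"
          using \<open>bij h\<close> by (metis bij_pointE)
        then have "h (0, K.const (csum (snd t))) = (0, K'.const (\<eta> x - \<eta> y))"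
          by (subst trace) (simp add: csum_def axis_def)
        ultimately have "(x - y, 0) = (0, K.const (csum (snd t)))"
          using \<open>bij h\<close> by (metis bij_is_inj injD)
        then show "x = y" by simp
      qed
      show "surj \<phi>"
        unfolding surj_def
      proof
        fix b
        obtain t where t: "h t = (b, 0)"
          using \<open>bij h\<close> by (metis bij_pointE)
        \<comment> \<open>A preimage of a fixed element is fixed, and its constant part adds nothing
          to the K-component of the image.\<close>
        then have "h (tau_KW t) = h t"
          by (simp add: tau K'.tau_KW_eq zero_vec_def)
        then have "tau_KW t = t"
          using \<open>bij h\<close> by (metis bij_is_inj injD)
        then obtain z where "t = (fst t, 0) + (0, K.const z)"
          unfolding K.tau_KW_fixed_iff by (metis add_0 add_0_right add_Pair prod.collapse)
        then have "h t = h (fst t, 0) + h (0, K.const z)"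
          by (metis hs(1))
        then have "b = \<phi> (fst t)"
          by (simp add: t h_K h_const)
        then show "\<exists>x. b = \<phi> x" by blast
      qed
    qed
  qed
  \<comment> \<open>Surjectivity makes \<open>c\<close> a unit: some element is mapped to one with
    coordinate sum 1.\<close>
  obtain t where "h t = (0, axis 0 (unity K'))"
    using \<open>bij h\<close> by (metis bij_pointE)
  then have "mul K' (\<phi> (csum (snd t))) c = unity K'"
    using csum_h[of "fst t" "snd t"] by (simp add: csum_def axis_def)
  then have "nrm K' c \<noteq> 0"
    by (metis K'.nrm_mul K'.nrm_unity mult_zero_right zero_neq_one)
  define w where "w i = (axis i (unity K) :: 'k ^ 3)" for i
  obtain \<beta> x where x: "h (0, w 0) = (\<beta>, x)" by fastforce
  have cx: "csum x = c" using x by (simp add: c_def w_def)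
  have "(0, w 1) = tau_KW (0, w 0)"
    by (simp add: w_def K.tau_KW_eq vec_3_eq_iff axis_def)
  then have x1: "h (0, w 1) = (\<beta>, \<chi> i. x $ (i - 1))"
    using tau[of "(0, w 0)"] unfolding x K'.tau_KW_eq by metis
  \<comment> \<open>The image of \<open>w 0\<close> may have a K-component \<open>\<beta>\<close>.
    As \<open>w 0\<close> squares to zero, the trace of \<open>\<beta>\<close> annihilates
    \<open>c\<close>, so \<open>\<beta>\<close> drops out of the comparison below.\<close>
  have "mul ?A (0, w 0) (0, w 0) = 0"
    by (simp add: K.mul_KW K.cross_prod_self K.sigma_form_eq w_def axis_def vec_eq_iff zero_prod_def)
  then have "mul ?B (\<beta>, x) (\<beta>, x) = 0"
    by (metis hs(3,4) x)
  then have "mul K' (\<beta> + hconj K' \<beta>) (x $ i) = 0" for i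
    by (simp add: K'.mul_KW K'.cross_prod_self vec_eq_iff zero_prod_def K'.add_mul)
  then have \<beta>: "mul K' (\<beta> + hconj K' \<beta>) c = 0"
    by (simp add: csum_def K'.mul_add flip: cx)
  have "csum (snd (mul ?A (0, w 0) (0, w 1))) = csum (cross_prod K a (w 0) (w 1))"
    by (simp add: K.mul_KW csum_def)
  also have "\<dots> = hconj K a"
    by (simp add: K.csum_cross_prod) (simp add: csum_def K.minor_def w_def axis_def)
  finally have "csum (snd (h (mul ?A (0, w 0) (0, w 1)))) = mul K' (\<phi> (hconj K a)) c"
    by (metis csum_h prod.collapse)
  moreover have "csum (snd (h (mul ?A (0, w 0) (0, w 1))))
    = mul K' (\<beta> + hconj K' \<beta>) c + csum (cross_prod K' a' x (\<chi> i. x $ (i - 1)))"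
    unfolding hs x x1 K'.mul_KW
    by (simp add: csum_def K'.mul_add K'.add_mul add_ac flip: cx)
  \<comment> \<open>The coordinate sum of \<open>w 0\<close> times \<open>w 1\<close>, computed
    before and after \<open>h\<close>. Taking norms gives n(c) = 1; conjugating then yields the
    cube.\<close>
  ultimately have eq: "mul K' (\<phi> (hconj K a)) c = hconj K' (mul K' a' (mul K' c c))"
    by (simp add: \<beta> K'.csum_cross_prod K'.csum_minor_shift cx)
  have nrm_cj: "nrm K' (hconj K' z) = nrm K' z" for z
    using K'.mul_cj[of z] K'.mul_cj[of "hconj K' z"]
    by (simp add: K'.mul_commute K'.unity_neq_0)
  have "nrm K' c = nrm K' c * nrm K' c"
    using arg_cong[OF eq, of "nrm K'"]
    by (simp add: K'.nrm_mul nrm_cj hconj_alg_iso[OF \<phi>] nrm_alg_iso[OF \<phi>] na)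
  with \<open>nrm K' c \<noteq> 0\<close> have "nrm K' c = 1" by simp
  then have cc: "mul K' (hconj K' c) c = unity K'"
    using K'.nrm_1_cancel by (simp add: K'.mul_commute)
  have "mul K' (\<phi> a) (hconj K' c) = mul K' a' (mul K' c c)"
    using arg_cong[OF eq, of "hconj K'"] by (simp add: hconj_alg_iso[OF \<phi>] K'.cj_mul')
  then have "mul K' (mul K' (\<phi> a) (hconj K' c)) c = mul K' (mul K' a' (mul K' c c)) c"
    by simp
  then have "\<phi> a = mul K' (mul K' a' (mul K' c c)) c"
    by (simp add: K'.mul_assoc cc)
  then have "\<phi> a = mul K' (mul K' (mul K' c c) c) a'"
    by (simp add: K'.mul_ac)
  with \<phi> show ?thesis by (rule that)
qed

end

section \<open>A normalized vector\<close>

text \<open>\<open>j\<close> is a trace-zero generator of the fixed etale subalgebra, and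
  \<open>trace_nonzero\<close> is (\<tau> - 1)^2 \<noteq> 0 in characteristic 3.\<close>

locale order3_aut = hurwitz_alg C for C :: "('f::field, 'c::ab_group_add) unital_normed_alg" +
  fixes \<tau> :: "'c \<Rightarrow> 'c" and j :: 'c
  assumes char3: "CHAR('f) = 3"
    and dim_UNIV: "dim UNIV = 8"
    and aut: "alg_automorphism C \<tau>"
    and tau_tau_tau [simp]: "\<tau> (\<tau> (\<tau> x)) = x"
    and trace_nonzero: "\<exists>x. x + \<tau> x + \<tau> (\<tau> x) \<noteq> 0"
    and polar_j_unity [simp]: "N j e = 0"
    and nrm_j: "n j \<noteq> 0"
    and tau_j [simp]: "\<tau> j = j"
begin

lemma three_0: "(3::'f) = 0"
  using of_nat_CHAR[where 'a = 'f] char3 by simp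

lemma two_eq: "(2::'f) = - 1"
  using three_0 by (simp add: eq_neg_iff_add_eq_0)

lemma two_neq_0: "(2::'f) \<noteq> 0"
  by (simp add: two_eq)

lemma unity_neq_0: "e \<noteq> 0"
  using nrm_j unity_mul[of j] by (metis mul_zero(1) nrm_zero)

lemma nrm_unity [simp]: "n e = 1"
  by (simp add: nrm_unity_eq_1 unity_neq_0)

lemma polar_unity_j [simp]: "N e j = 0"
  by (simp add: polar_sym)

lemma tau_add: "\<tau> (x + y) = \<tau> x + \<tau> y" and tau_smul: "\<tau> (c \<diamondop> x) = c \<diamondop> \<tau> x"
  and tau_mul: "\<tau> (x \<star> y) = \<tau> x \<star> \<tau> y"
  and tau_diff: "\<tau> (x - y) = \<tau> x - \<tau> y"
  by (rule alg_iso_add alg_iso_smul alg_iso_mul alg_iso_diff, rule aut)+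

lemma tau_unity [simp]: "\<tau> e = e"
  by (rule alg_iso_unity[OF hurwitz_alg_axioms hurwitz_alg_axioms aut])

lemma nrm_tau [simp]: "n (\<tau> x) = n x"
  using alg_iso_trace_nrm[OF hurwitz_alg_axioms hurwitz_alg_axioms aut unity_neq_0] by blast

lemma polar_tau [simp]: "N (\<tau> x) (\<tau> y) = N x y"
  by (simp add: polar_def flip: tau_add)

definition W where "W = {x. N x e = 0 \<and> N x j = 0}"

lemma W_D: "x \<in> W \<Longrightarrow> N x e = 0" "x \<in> W \<Longrightarrow> N x j = 0" "x \<in> W \<Longrightarrow> N e x = 0" "x \<in> W \<Longrightarrow> N j x = 0"
  by (simp_all add: W_def polar_sym)

lemma W_add: "x \<in> W \<Longrightarrow> y \<in> W \<Longrightarrow> x + y \<in> W"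
  and W_smul: "x \<in> W \<Longrightarrow> c \<diamondop> x \<in> W"
  and W_minus: "x \<in> W \<Longrightarrow> - x \<in> W"
  and W_diff: "x \<in> W \<Longrightarrow> y \<in> W \<Longrightarrow> x - y \<in> W"
  by (simp_all add: W_def polar_add_left polar_smul_left polar_minus polar_diff)

lemma W_tau: "x \<in> W \<Longrightarrow> \<tau> x \<in> W"
  unfolding W_def by (metis (mono_tags) mem_Collect_eq polar_tau tau_j tau_unity)

lemma cj_j: "cj j = - j"
  by (simp add: cj_eq_minus)

lemma j_mul_j: "j \<star> j = (- n j) \<diamondop> e"
  by (simp add: mul_self)

lemma j_mul_j_mul: "j \<star> (j \<star> x) = (- n j) \<diamondop> x"
  using cj_mul_mul[of j x] by (simp add: cj_j mul_minus minus_equation_iff)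

lemma polar_j_mul: "N (j \<star> x) y = - N x (j \<star> y)"
  by (simp add: polar_mul_adjoint_left cj_j mul_minus polar_minus)

lemma polar_j_mul_self [simp]: "N (j \<star> x) x = 0"
  using polar_mul_right_cancel[of j x e] by simp

lemma polar_self_j_mul [simp]: "N x (j \<star> x) = 0"
  using polar_j_mul_self[of x] by (simp add: polar_sym)

lemma nrm_j_mul: "n (j \<star> x) = n j * n x"
  by (rule nrm_mul)

lemma W_j_mul: "x \<in> W \<Longrightarrow> j \<star> x \<in> W"
  by (simp add: W_def polar_j_mul j_mul_j polar_smul_right polar_minus)

lemmas W_intros = W_add W_smul W_minus W_diff W_tau W_j_mul

lemma W_decompose:
  obtains y p q where "y \<in> W" "x = p \<diamondop> e + q \<diamondop> j + y"
proof
  let ?p = "N x e / 2" and ?q = "N x j / (2 * n j)"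
  show "x - (?p \<diamondop> e + ?q \<diamondop> j) \<in> W"
    using two_neq_0 nrm_j
    by (simp add: W_def polar_diff polar_add_left polar_smul_left polar_self)
  show "x = ?p \<diamondop> e + ?q \<diamondop> j + (x - (?p \<diamondop> e + ?q \<diamondop> j))" by simp
qed

lemma polar_tau_tau: "N (\<tau> (\<tau> x)) y = N x (\<tau> y)"
  by (metis polar_tau tau_tau_tau)

lemma triple_vec: "x + x + x = 0" for x :: 'c
  by (rule char3_add[OF char3])

text \<open>The quadratic form n(x) + N(\<tau>x, x) has polar form N(Tx, y) with T = 1 + \<tau> +
  \<tau>^2. If it vanished on W, so would T; and on F1 + Fj the operator T is multiplication by
  3.\<close>

lemma exists_trace_anisotropic: "\<exists>x\<in>W. n x + N (\<tau> x) x \<noteq> 0"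
proof (rule ccontr)
  assume "\<not> ?thesis"
  then have q: "n x + N (\<tau> x) x = 0" if "x \<in> W" for x using that by blast
  define T where "T x = x + \<tau> x + \<tau> (\<tau> x)" for x
  have W0: "T x = 0" if x: "x \<in> W" for x
  proof (rule polar_nondegenerate)
    fix z
    obtain y p r where y: "y \<in> W" and z: "z = p \<diamondop> e + r \<diamondop> j + y" by (rule W_decompose)
    have "N (T x) y = N x y + N (\<tau> x) y + N (\<tau> y) x"
      by (simp add: T_def polar_add_left polar_tau_tau polar_sym[of x "\<tau> y"])
    also have "\<dots> = (n (x + y) + N (\<tau> (x + y)) (x + y)) - (n x + N (\<tau> x) x) - (n y + N (\<tau> y) y)"
      by (simp add: nrm_add tau_add polar_add_left polar_add_right)
    also have "\<dots> = 0"
      using q x y W_add by simp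
    finally have "N (T x) y = 0" .
    moreover have "T x \<in> W"
      using x by (auto simp: T_def intro!: W_intros)
    ultimately show "N (T x) z = 0"
      by (simp add: z polar_add_right polar_smul_right W_D)
  qed
  have "T x = 0" for x
  proof -
    obtain y p r where y: "y \<in> W" and x: "x = p \<diamondop> e + r \<diamondop> j + y" by (rule W_decompose)
    have "T x = (p \<diamondop> e + p \<diamondop> e + p \<diamondop> e) + (r \<diamondop> j + r \<diamondop> j + r \<diamondop> j) + T y"
      by (simp add: x T_def tau_add tau_smul add_ac)
    then show ?thesis by (simp only: triple_vec W0[OF y] add_0)
  qed
  then show False
    using trace_nonzero by (simp add: T_def)
qed

lemma exists_isotropic:
  obtains x where "x \<in> W" "n x = 0" "N (\<tau> x) x \<noteq> 0"
proof -
  obtain x where x: "x \<in> W" "n x + N (\<tau> x) x \<noteq> 0"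
    using exists_trace_anisotropic by blast
  define \<epsilon> where "\<epsilon> = n x + N (\<tau> x) x"
  \<comment> \<open>The trace \<open>t\<close> is isotropic, its norm being a multiple of 3, and
    N(x, t) = -\<epsilon>. So n(x + \<mu>t) = 0 is a linear equation, solved by this
    \<open>\<mu>\<close>.\<close>
  define \<mu> where "\<mu> = n x / \<epsilon>"
  define t where "t = x + \<tau> x + \<tau> (\<tau> x)"
  define y where "y = x + \<mu> \<diamondop> t"
  have \<mu>: "\<mu> * \<epsilon> = n x" using x by (simp add: \<mu>_def \<epsilon>_def)
  have t [simp]: "\<tau> t = t" by (simp add: t_def tau_add add_ac)
  have g: "N x (\<tau> x) = N (\<tau> x) x" "N x (\<tau> (\<tau> x)) = N (\<tau> x) x"
    by (metis polar_sym polar_tau_tau)+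
  have "n t = 3 * (n x + N (\<tau> x) x)"
    by (simp add: t_def nrm_add polar_add_left polar_add_right g algebra_simps)
  then have nt: "n t = 0"
    by (simp only: three_0) simp
  have "N x t = 2 * \<epsilon>"
    by (simp add: t_def polar_add_right polar_self g \<epsilon>_def)
  then have Nt: "N x t = - \<epsilon>"
    by (simp add: two_eq)
  have Nt': "N (\<tau> x) t = - \<epsilon>" "N t x = - \<epsilon>"
    using Nt polar_tau[of x t] by (simp_all add: polar_sym)
  have "y \<in> W"
    using x by (auto simp: y_def t_def intro!: W_intros)
  moreover have "n y = 0"
    using \<mu> by (simp add: y_def nrm_add nrm_smul nt polar_smul_right Nt)
  moreover have "N (\<tau> y) y = N (\<tau> x) x - 2 * (\<mu> * \<epsilon>)"
    by (simp add: y_def tau_add tau_smul polar_add_left polar_add_right polar_smul_left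
        polar_smul_right Nt' polar_self nt)
  then have "N (\<tau> y) y = \<epsilon>"
    using \<mu> by (simp add: \<epsilon>_def two_eq)
  ultimately show ?thesis
    using that x by (simp add: \<epsilon>_def)
qed

text \<open>The last condition says that \<sigma>(\<tau>w, w) has no j-part. One correction achieves
  it and keeps the vector isotropic: the terms \<nu>m and \<nu>^2 n(j) n(\<tau>x - x) = -\<nu>^2
  n(j) \<epsilon> of the norm cancel.\<close>

lemma exists_normalized:
  obtains w where "w \<in> W" "n w = 0" "N (\<tau> w) w \<noteq> 0" "N (j \<star> \<tau> w) w = 0"
proof -
  obtain x where x: "x \<in> W" "n x = 0" "N (\<tau> x) x \<noteq> 0" by (rule exists_isotropic)
  define x1 where "x1 = \<tau> x"
  define x2 where "x2 = \<tau> x1"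
  define \<epsilon> where "\<epsilon> = N x1 x"
  define m where "m = N (j \<star> x1) x"
  \<comment> \<open>the coefficient that cancels the \<open>j\<close>-part of \<open>\<sigma>(\<tau>x, x)\<close>\<close>
  define \<nu> where "\<nu> = m / (n j * \<epsilon>)"
  define w where "w = x + \<nu> \<diamondop> (j \<star> (x1 - x))"
  have tau_x: "\<tau> x = x1" "\<tau> x1 = x2" "\<tau> x2 = x"
    by (simp_all add: x1_def x2_def)
  have \<epsilon>: "\<epsilon> \<noteq> 0" using x by (simp add: \<epsilon>_def x1_def)
  have nx: "n x1 = 0" "n x2 = 0" using x by (simp_all add: x1_def x2_def)
  have gram1: "N x1 x = \<epsilon>" "N x2 x1 = \<epsilon>" "N x x2 = \<epsilon>"
    using polar_tau[of x1 x] polar_tau[of x2 x1] by (simp_all add: tau_x \<epsilon>_def)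
  then have gram2: "N x x1 = \<epsilon>" "N x1 x2 = \<epsilon>" "N x2 x = \<epsilon>"
    by (metis polar_sym)+
  have skew1: "N (j \<star> x1) x = m" "N (j \<star> x2) x1 = m" "N (j \<star> x) x2 = m"
    using polar_tau[of "j \<star> x1" x] polar_tau[of "j \<star> x2" x1]
    by (simp_all add: tau_x tau_mul m_def)
  have skew2: "N (j \<star> x) x1 = - m" "N (j \<star> x1) x2 = - m" "N (j \<star> x2) x = - m"
    using skew1 by (metis polar_j_mul polar_sym)+
  note skew3 = polar_sym[of x "j \<star> b" for b] polar_sym[of x1 "j \<star> b" for b]
    polar_sym[of x2 "j \<star> b" for b]
  note expand = polar_add_left polar_add_right polar_diff polar_smul_left polar_smul_right
    mul_diff mul_add mul_smul polar_mul_left_cancel j_mul_j_mul polar_minus polar_self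
  have \<nu>: "m = \<nu> * (n j * \<epsilon>)"
    using \<epsilon> nrm_j by (simp add: \<nu>_def)
  have tw: "\<tau> w = x1 + \<nu> \<diamondop> (j \<star> (x2 - x1))"
    by (simp add: w_def tau_add tau_smul tau_mul tau_diff tau_x)
  have wW: "w \<in> W"
    using x by (auto simp: w_def x1_def intro!: W_intros)
  have "n (x1 - x) = - \<epsilon>"
    using nrm_add[of x1 "- x"] x nx by (simp add: polar_minus gram1 nrm_minus)
  moreover have "N x (j \<star> (x1 - x)) = m"
    by (simp add: mul_diff polar_diff skew3 skew1)
  ultimately have "n w = 0"
    using x \<nu>
    by (simp add: w_def nrm_add nrm_smul nrm_j_mul polar_smul_right power2_eq_square)
  moreover have "N (\<tau> w) w = \<epsilon>"
    unfolding tw unfolding w_def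
    by (simp add: x nx expand gram1 gram2 skew3 skew1 skew2 algebra_simps \<nu> nrm_mul three_0)
  moreover have "N (j \<star> \<tau> w) w = 0"
    unfolding tw unfolding w_def
    by (simp add: x nx expand gram1 gram2 skew3 skew1 skew2 algebra_simps \<nu> nrm_mul three_0)
  ultimately show ?thesis using that wW \<epsilon> by simp
qed

end

section \<open>The basis of \<open>W\<close>\<close>

text \<open>F[X]/(X^2 - \<alpha>), with (p, q) for p + qX. Algebras live on full types, so F1 + Fj
  needs such a copy, with \<alpha> = -n(j), to serve as K.\<close>

definition quad_alg :: "'f::field \<Rightarrow> ('f, 'f \<times> 'f) unital_normed_alg" where
  "quad_alg \<alpha> =
     \<lparr>smul = (\<lambda>c (p, q). (c * p, c * q)),
      mul = (\<lambda>(p, q) (p', q'). (p * p' + \<alpha> * q * q', p * q' + q * p')),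
      nrm = (\<lambda>(p, q). p\<^sup>2 - \<alpha> * q\<^sup>2),
      unity = (1, 0)\<rparr>"

lemma quad_alg_simps [simp]:
  "smul (quad_alg \<alpha>) c (p, q) = (c * p, c * q)"
  "mul (quad_alg \<alpha>) (p, q) (p', q') = (p * p' + \<alpha> * q * q', p * q' + q * p')"
  "nrm (quad_alg \<alpha>) (p, q) = p\<^sup>2 - \<alpha> * q\<^sup>2"
  "unity (quad_alg \<alpha>) = (1, 0)"
  by (simp_all add: quad_alg_def)

lemma polar_quad_alg [simp]:
  "polar (nrm (quad_alg \<alpha>)) (p, q) (p', q') = 2 * p * p' - 2 * \<alpha> * q * q'"
  by (simp add: polar_def power2_eq_square algebra_simps)

lemma hconj_quad_alg [simp]: "hconj (quad_alg \<alpha>) (p, q) = (p, - q)"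
  by (simp add: hconj_def)

lemma vector_space_quad_alg: "vector_space (smul (quad_alg \<alpha>))"
  by unfold_locales (auto simp: algebra_simps)

lemma quadratic_etale_quad_alg:
  fixes \<alpha> :: "'f::field"
  assumes "\<alpha> \<noteq> 0" "(2::'f) \<noteq> 0"
  shows "quadratic_etale (quad_alg \<alpha>)"
proof -
  interpret L: vector_space "smul (quad_alg \<alpha>)"
    by (rule vector_space_quad_alg)
  have "hurwitz_on (quad_alg \<alpha>) UNIV"
    unfolding hurwitz_on_def
  proof (intro conjI ballI allI impI)
    fix x :: "'f \<times> 'f"
    assume "\<forall>y\<in>UNIV. polar (nrm (quad_alg \<alpha>)) x y = 0"
    then have "polar (nrm (quad_alg \<alpha>)) x (1, 0) = 0" "polar (nrm (quad_alg \<alpha>)) x (0, 1) = 0"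
      by blast+
    then show "x = 0"
      using assms by (cases x) (simp add: zero_prod_def)
  qed (auto simp: L.vector_space_axioms algebra_simps power2_eq_square)
  moreover have "L.dim UNIV = 2"
  proof (rule L.dim_unique)
    let ?B = "{(1, 0), (0, 1)} :: ('f \<times> 'f) set"
    have "(p, q) \<in> L.span ?B" for p q
    proof -
      have "(p, q) = smul (quad_alg \<alpha>) p (1, 0) + smul (quad_alg \<alpha>) q (0, 1)" by simp
      then show ?thesis
        by (metis L.span_add L.span_base L.span_scale insertCI)
    qed
    then show "UNIV \<subseteq> L.span ?B" by auto
    show "L.independent ?B"
      by (auto simp: L.independent_insert L.span_singleton L.independent_empty zero_prod_def)
  qed auto
  ultimately show ?thesis
    by (simp add: quadratic_etale_on_def)
qed

lemma UNIV_cayley_index: "UNIV = {E1, E2} \<union> (range U \<union> range V)"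
proof -
  have "x \<in> {E1, E2} \<union> (range U \<union> range V)" for x
    by (cases x) auto
  then show ?thesis by blast
qed

lemma sum_cayley_index:
  "(\<Sum>b\<in>UNIV. f b) = f E1 + f E2 + (f (U 0) + f (U 1) + f (U 2)) + (f (V 0) + f (V 1) + f (V 2))"
  for f :: "cayley_index \<Rightarrow> 'a::comm_monoid_add"
proof -
  have "(\<Sum>b\<in>UNIV. f b) = sum f {E1, E2} + (sum f (range U) + sum f (range V))"
    unfolding UNIV_cayley_index
    by (subst sum.union_disjoint, auto)+
  moreover have "sum f (range U) = (\<Sum>i\<in>UNIV. f (U i))"
    by (subst sum.reindex) (auto simp: inj_def)
  moreover have "sum f (range V) = (\<Sum>i\<in>UNIV. f (V i))"
    by (subst sum.reindex) (auto simp: inj_def)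
  ultimately show ?thesis
    by (simp add: sum_3' add.assoc)
qed

lemma card_cayley_index: "CARD(cayley_index) = 8"
  using sum_cayley_index[of "\<lambda>_. 1 :: nat"] by simp

section \<open>The orbit of w as a basis of W over F1 + Fj\<close>

locale order3_aut_vec = order3_aut +
  fixes w
  assumes w_W: "w \<in> W" and nrm_w: "n w = 0"
    and eps_neq_0: "N (\<tau> w) w \<noteq> 0" and skew_w: "N (j \<star> \<tau> w) w = 0"
begin

definition \<epsilon> where "\<epsilon> = N (\<tau> w) w"

definition wv :: "3 \<Rightarrow> 'b" where
  "wv i = (if i = 0 then w else if i = 1 then \<tau> w else \<tau> (\<tau> w))"

lemma wv_simps: "wv 0 = w" "wv 1 = \<tau> w" "wv 2 = \<tau> (\<tau> w)"
  by (simp_all add: wv_def)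

lemma tau_wv: "\<tau> (wv 0) = wv 1" "\<tau> (wv 1) = wv 2" "\<tau> (wv 2) = wv 0"
  by (simp_all add: wv_simps)

lemma wv_W: "wv i \<in> W"
  by (simp add: wv_def w_W W_tau)

lemma nrm_wv: "n (wv i) = 0"
  by (simp add: wv_def nrm_w)

lemma gram: "N (wv 0) (wv 1) = \<epsilon>" "N (wv 0) (wv 2) = \<epsilon>" "N (wv 1) (wv 0) = \<epsilon>"
  "N (wv 1) (wv 2) = \<epsilon>" "N (wv 2) (wv 0) = \<epsilon>" "N (wv 2) (wv 1) = \<epsilon>" "N (wv i) (wv i) = 0"
proof -
  show *: "N (wv 1) (wv 0) = \<epsilon>" "N (wv 2) (wv 1) = \<epsilon>" "N (wv 0) (wv 2) = \<epsilon>"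
    by (simp_all add: wv_simps \<epsilon>_def) (metis polar_tau tau_tau_tau)
  then show "N (wv 0) (wv 1) = \<epsilon>" "N (wv 1) (wv 2) = \<epsilon>" "N (wv 2) (wv 0) = \<epsilon>"
    by (metis polar_sym)+
  show "N (wv i) (wv i) = 0" by (simp add: polar_self nrm_wv)
qed

text \<open>Apply \<tau> to \<open>skew_w\<close> and use that multiplication by \<open>j\<close> is
  skew. Together with \<open>gram\<close>, all \<sigma>(w_i, w_k) are scalars.\<close>

lemma skew: "N (j \<star> wv i) (wv k) = 0"
proof -
  have 1: "N (j \<star> wv 1) (wv 0) = 0" using skew_w by (simp add: wv_simps)
  have 2: "N (j \<star> wv 2) (wv 1) = 0"
    using polar_tau[of "j \<star> wv 1" "wv 0"] by (simp add: tau_mul tau_wv 1)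
  have 3: "N (j \<star> wv 0) (wv 2) = 0"
    using polar_tau[of "j \<star> wv 2" "wv 1"] by (simp add: tau_mul tau_wv 2)
  have "\<forall>i k. N (j \<star> wv i) (wv k) = 0"
    unfolding all_3 using 1 2 3 by (simp add: polar_j_mul[of "wv 0" "wv 1"]
        polar_j_mul[of "wv 1" "wv 2"] polar_j_mul[of "wv 2" "wv 0"]
        polar_sym[of "wv k" "j \<star> wv i" for i k])
  then show ?thesis by blast
qed

lemma skew': "N (wv i) (j \<star> wv k) = 0"
  using skew[of k i] by (simp add: polar_sym)

definition \<iota> :: "'a \<times> 'a \<Rightarrow> 'b" where
  "\<iota> s = fst s \<diamondop> e + snd s \<diamondop> j"

definition f :: "('a \<times> 'a) \<times> (('a \<times> 'a) ^ 3) \<Rightarrow> 'b" where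
  "f = (\<lambda>(b, x). \<iota> b + (\<iota> (x $ 0) \<star> wv 0 + \<iota> (x $ 1) \<star> wv 1 + \<iota> (x $ 2) \<star> wv 2))"

lemma iota_mul: "\<iota> s \<star> v = fst s \<diamondop> v + snd s \<diamondop> (j \<star> v)"
  by (simp add: \<iota>_def add_mul smul_mul)

lemma iota_add: "\<iota> (s + t) = \<iota> s + \<iota> t" and iota_diff: "\<iota> (s - t) = \<iota> s - \<iota> t"
  and iota_minus: "\<iota> (- s) = - \<iota> s" and iota_0: "\<iota> 0 = 0"
  by (simp_all add: \<iota>_def algebra_simps)

lemma f_add: "f (s + t) = f s + f t"
  by (cases s; cases t) (simp add: f_def iota_add add_mul add_ac)

text \<open>These eight pairings recover the coordinates; they prove \<open>f\<close> injective and
  later identify the product of two basis vectors.\<close>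

lemma polar_f:
  "N (f (b, x)) e = 2 * fst b"
  "N (f (b, x)) j = 2 * n j * snd b"
  "N (f (b, x)) (wv 0) = \<epsilon> * (fst (x $ 1) + fst (x $ 2))"
  "N (f (b, x)) (wv 1) = \<epsilon> * (fst (x $ 0) + fst (x $ 2))"
  "N (f (b, x)) (wv 2) = \<epsilon> * (fst (x $ 0) + fst (x $ 1))"
  "N (f (b, x)) (j \<star> wv 0) = n j * \<epsilon> * (snd (x $ 1) + snd (x $ 2))"
  "N (f (b, x)) (j \<star> wv 1) = n j * \<epsilon> * (snd (x $ 0) + snd (x $ 2))"
  "N (f (b, x)) (j \<star> wv 2) = n j * \<epsilon> * (snd (x $ 0) + snd (x $ 1))"
  by (simp_all add: f_def \<iota>_def add_mul smul_mul polar_add_left polar_smul_left polar_self gram skew skew'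
      W_D[OF wv_W] W_D[OF W_j_mul[OF wv_W]] polar_mul_left_cancel nrm_mul nrm_wv distrib_left mult_ac)

lemma cyclic_sums_0:
  assumes "p1 + p2 = 0" "p0 + p2 = 0" "p0 + p1 = (0::'a)"
  shows "p0 = 0 \<and> p1 = 0 \<and> p2 = 0"
proof -
  have "p1 = p2" "p0 = p2" using assms by (metis add_left_cancel add.commute)+
  then have "2 * p2 = 0" using assms(1) unfolding mult_2 by blast
  with two_neq_0 have "p2 = 0" by simp
  with \<open>p1 = p2\<close> \<open>p0 = p2\<close> show ?thesis by simp
qed

lemma f_eq_0:
  assumes "f (b, x) = 0"
  shows "b = 0 \<and> x = 0"
proof -
  have "fst b = 0" "snd b = 0"
    using polar_f(1,2)[of b x] assms two_neq_0 nrm_j by simp_all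
  moreover have "fst (x $ 0) = 0 \<and> fst (x $ 1) = 0 \<and> fst (x $ 2) = 0"
    using polar_f(3-5)[of b x] assms eps_neq_0 by (intro cyclic_sums_0) (simp_all add: \<epsilon>_def)
  moreover have "snd (x $ 0) = 0 \<and> snd (x $ 1) = 0 \<and> snd (x $ 2) = 0"
    using polar_f(6-8)[of b x] assms eps_neq_0 nrm_j
    by (intro cyclic_sums_0) (simp_all add: \<epsilon>_def)
  ultimately show ?thesis
    by (simp add: vec_3_eq_iff prod_eq_iff)
qed

lemma bij_f: "bij f"
proof (rule bijI)
  show "inj f"
  proof (rule injI)
    fix s t assume "f s = f t"
    then have "f (s - t) = 0"
      using f_add[of "s - t" t] by simp
    then have "fst (s - t) = 0 \<and> snd (s - t) = 0"
      by (metis f_eq_0 prod.collapse)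
    then show "s = t" by (simp add: prod_eq_iff)
  qed
  then have inj: "f s = f t \<Longrightarrow> s = t" for s t by (simp add: injD)
  \<comment> \<open>\<open>'a ^ cayley_index\<close> serves as a coordinate space of dimension 8: a
    linear injection between spaces of equal dimension is surjective.\<close>
  define g where "g v = f ((v $ E1, v $ E2), \<chi> i. (v $ U i, v $ V i))" for v :: "'a ^ cayley_index"
  have g_add: "g (u + v) = g u + g v" for u v
    by (simp add: g_def f_def \<iota>_def add_mul smul_mul algebra_simps)
  have g_smul: "g (c *s v) = c \<diamondop> g v" for c v
    by (simp add: g_def f_def \<iota>_def add_mul smul_mul algebra_simps)
  have inj_g: "inj g"
  proof (rule injI)
    fix u v assume "g u = g v"
    then have "((u $ E1, u $ E2), \<chi> i. (u $ U i, u $ V i)) = ((v $ E1, v $ E2), \<chi> i. (v $ U i, v $ V i))"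
      unfolding g_def by (rule inj)
    then have "u $ E1 = v $ E1" "u $ E2 = v $ E2" "u $ U i = v $ U i" "u $ V i = v $ V i" for i
      by (simp_all add: vec_eq_iff)
    then show "u = v"
      by (metis (full_types) vec_eq_iff cayley_index.exhaust)
  qed
  obtain B where B: "independent B" "span B = UNIV" "card B = 8"
    using basis_exists[of UNIV] dim_UNIV by (metis top.extremum_uniqueI)
  then have "finite B" by (metis card.infinite zero_neq_numeral)
  interpret fin: finite_dimensional_vector_space "smul C" B
    using B \<open>finite B\<close> by unfold_locales auto
  interpret pair: finite_dimensional_vector_space_pair "(*s) :: 'a \<Rightarrow> 'a ^ cayley_index \<Rightarrow> _"
    cart_basis "smul C" B ..
  have "Vector_Spaces.linear (*s) (smul C) g"
    by unfold_locales (simp_all add: g_add g_smul)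
  moreover have "vec.dim (UNIV :: ('a ^ cayley_index) set) = dim UNIV"
    by (simp add: vec.dim_UNIV card_cart_basis card_cayley_index dim_UNIV B(3))
  ultimately have "surj g"
    using inj_g pair.linear_injective_imp_surjective by metis
  then show "surj f"
    unfolding surj_def g_def by metis
qed

lemma product_12:
  obtains p q where "wv 1 \<star> wv 2 = \<epsilon> \<diamondop> e + \<iota> (p, q) \<star> (wv 1 + wv 2 - wv 0)" "p\<^sup>2 + n j * q\<^sup>2 = \<epsilon>"
proof -
  obtain b x where bx: "wv 1 \<star> wv 2 = f (b, x)"
    using bij_f by (metis bij_pointE surj_pair)
  have cjw: "cj (wv i) = - wv i" for i
    using wv_W[of i] by (simp add: cj_eq_minus W_D)
  have jw: "j \<star> wv i = - (wv i \<star> j)" for i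
    using mul_cj_swap[of "wv i" j] wv_W[of i] by (simp add: W_D cj_j mul_minus)
  have "N (wv 1 \<star> wv 2) e = - \<epsilon>"
    using polar_mul_adjoint_left[of "wv 1" "wv 2" e] by (simp add: cjw polar_minus gram)
  then have "fst b = \<epsilon>"
    by (simp add: bx polar_f two_eq)
  have "N (wv 1 \<star> wv 2) j = 0"
    using polar_mul_adjoint_left[of "wv 1" "wv 2" j] jw[of 1] skew'[of 2 1]
    by (simp add: cjw polar_minus mul_minus)
  then have "snd b = 0"
    using two_neq_0 nrm_j by (simp add: bx polar_f)
  \<comment> \<open>Multiplication by an isotropic u has totally isotropic image: N(uv, uz) = n(u)
    N(v,z) = 0. Taking z = 1 and z = j, on the left and on the right, makes the three W-coordinates
    equal up to sign.\<close>
  have "N (wv 1 \<star> wv 2) (wv 1) = 0"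
    using polar_mul_left_cancel[of "wv 1" "wv 2" e] by (simp add: nrm_wv)
  then have 1: "fst (x $ 2) = - fst (x $ 0)"
    using eps_neq_0 by (simp add: bx polar_f \<epsilon>_def eq_neg_iff_add_eq_0 add.commute)
  have "N (wv 1 \<star> wv 2) (wv 2) = 0"
    using polar_mul_right_cancel[of "wv 1" "wv 2" e] by (simp add: nrm_wv)
  then have 2: "fst (x $ 1) = - fst (x $ 0)"
    using eps_neq_0 by (simp add: bx polar_f \<epsilon>_def eq_neg_iff_add_eq_0 add.commute)
  have "N (wv 1 \<star> wv 2) (j \<star> wv 1) = 0"
    using polar_mul_left_cancel[of "wv 1" "wv 2" j] by (simp add: nrm_wv jw polar_minus)
  then have 3: "snd (x $ 2) = - snd (x $ 0)"
    using eps_neq_0 nrm_j by (simp add: bx polar_f \<epsilon>_def eq_neg_iff_add_eq_0 add.commute)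
  have "N (wv 1 \<star> wv 2) (j \<star> wv 2) = 0"
    using polar_mul_right_cancel[of "wv 1" "wv 2" j] by (simp add: nrm_wv)
  then have 4: "snd (x $ 1) = - snd (x $ 0)"
    using eps_neq_0 nrm_j by (simp add: bx polar_f \<epsilon>_def eq_neg_iff_add_eq_0 add.commute)
  define p q where "p = - fst (x $ 0)" and "q = - snd (x $ 0)"
  let ?y = "wv 1 + wv 2 - wv 0"
  have prod: "wv 1 \<star> wv 2 = \<epsilon> \<diamondop> e + \<iota> (p, q) \<star> ?y"
    unfolding bx f_def
    using \<open>fst b = \<epsilon>\<close> \<open>snd b = 0\<close> 1 2 3 4
    by (simp add: \<iota>_def add_mul smul_mul p_def q_def algebra_simps mul_add mul_diff diff_mul mul_minus)
  have y: "?y \<in> W" by (intro W_intros wv_W)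
  have ny: "n ?y = - \<epsilon>"
    using nrm_add[of "wv 1 + wv 2" "- wv 0"]
    by (simp add: nrm_add nrm_minus nrm_wv polar_minus polar_add_left gram)
  have "0 = n (wv 1 \<star> wv 2)"
    by (simp add: nrm_mul nrm_wv)
  also have "\<dots> = \<epsilon>\<^sup>2 + (p\<^sup>2 + n j * q\<^sup>2) * n ?y"
    unfolding prod using W_D[OF y] W_D[OF W_j_mul[OF y]]
    by (simp add: iota_mul nrm_add nrm_smul nrm_mul polar_add_right polar_smul_left
        polar_smul_right distrib_right mult_ac)
  finally have "\<epsilon> * \<epsilon> = (p\<^sup>2 + n j * q\<^sup>2) * \<epsilon>"
    by (simp add: ny power2_eq_square)
  then have "p\<^sup>2 + n j * q\<^sup>2 = \<epsilon>"
    using eps_neq_0 by (simp add: \<epsilon>_def)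
  with prod show ?thesis by (rule that)
qed

end

section \<open>The multiplication table\<close>

lemma (in order3_aut_vec) rescale:
  obtains w' where "order3_aut_vec C \<tau> j w'" "N (\<tau> w') w' = 1"
proof -
  obtain p q where pq: "p\<^sup>2 + n j * q\<^sup>2 = \<epsilon>"
    by (rule product_12)
  \<comment> \<open>The element p + qj has norm \<epsilon>, so dividing it by \<epsilon> gives norm
    1/\<epsilon>. As \<open>s\<close> is fixed by \<tau>, multiplying by it scales N(\<tau>w, w) by
    its norm.\<close>
  define s where "s = \<iota> (p / \<epsilon>, q / \<epsilon>)"
  have \<epsilon>: "\<epsilon> \<noteq> 0" using eps_neq_0 by (simp add: \<epsilon>_def)
  have "n s = (p / \<epsilon>)\<^sup>2 + n j * (q / \<epsilon>)\<^sup>2"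
    by (simp add: s_def \<iota>_def nrm_add nrm_smul polar_smul_left polar_smul_right)
  also have "\<dots> = (p\<^sup>2 + n j * q\<^sup>2) / \<epsilon>\<^sup>2"
    by (simp add: power_divide add_divide_distrib)
  also have "\<dots> = 1 / \<epsilon>"
    unfolding pq using \<epsilon> by (simp add: power2_eq_square)
  finally have ns: "n s = 1 / \<epsilon>" .
  have \<tau>: "\<tau> (s \<star> w) = s \<star> \<tau> w"
    by (simp add: tau_mul s_def \<iota>_def tau_add tau_smul)
  have j: "j \<star> (s \<star> v) = s \<star> (j \<star> v)" for v
    by (simp add: s_def iota_mul mul_add mul_smul)
  have "s \<star> w \<in> W"
    unfolding s_def iota_mul by (intro W_intros w_W)
  moreover have "n (s \<star> w) = 0"
    by (simp add: nrm_mul nrm_w)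
  moreover have one: "N (\<tau> (s \<star> w)) (s \<star> w) = 1"
    using \<epsilon> by (simp add: \<tau> polar_mul_left_cancel ns \<epsilon>_def)
  moreover have "N (j \<star> \<tau> (s \<star> w)) (s \<star> w) = 0"
    by (simp add: \<tau> j polar_mul_left_cancel skew_w)
  ultimately have "order3_aut_vec C \<tau> j (s \<star> w)"
    by unfold_locales simp_all
  with one show ?thesis by (rule that[rotated])
qed

section \<open>Products of the normalized basis vectors\<close>

locale order3_aut_basis = order3_aut_vec +
  fixes k
  assumes eps_1: "N (\<tau> w) w = 1"
    and product_12': "wv 1 \<star> wv 2 = e + \<iota> k \<star> (wv 1 + wv 2 - wv 0)"
    and nrm_k: "(fst k)\<^sup>2 + n j * (snd k)\<^sup>2 = 1"
begin

abbreviation L where "L \<equiv> quad_alg (- n j)"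

sublocale L: KW L
proof -
  have "quadratic_etale L"
    using nrm_j two_neq_0 by (intro quadratic_etale_quad_alg) auto
  then show "KW L"
    by (simp add: quadratic_etale_iff KW_def KW_axioms_def char3)
qed

text \<open>The conjugate of \<open>k\<close>, because the coordinates of the cross product in
  \<open>KW_algebra\<close> are conjugated after multiplication by the parameter.\<close>

definition d where "d = hconj L k"

lemma nrm_d: "nrm L d = 1"
  unfolding d_def using nrm_k by (cases k) simp

lemma cj_d: "hconj L d = k"
  by (simp add: d_def)

lemma iota_times: "\<iota> (mul L s t) = \<iota> s \<star> \<iota> t"
  by (cases s; cases t)
    (simp add: \<iota>_def add_mul mul_add smul_mul mul_smul j_mul_j algebra_simps)

lemma iota_hconj: "\<iota> (hconj L s) = cj (\<iota> s)"
  by (cases s) (simp add: \<iota>_def cj_add cj_smul cj_j)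

lemma iota_smul: "\<iota> (smul L c s) = c \<diamondop> \<iota> s"
  by (cases s) (simp add: \<iota>_def algebra_simps)

lemma polar_iota: "v \<in> W \<Longrightarrow> N v (\<iota> s) = 0"
  by (simp add: \<iota>_def polar_add_right polar_smul_right W_D)

lemma iota_mul_W: "v \<in> W \<Longrightarrow> \<iota> s \<star> v \<in> W"
  by (simp add: iota_mul W_intros)

lemma iota_iota_mul: "\<iota> s \<star> (\<iota> t \<star> v) = \<iota> (mul L s t) \<star> v"
  by (cases s; cases t) (simp add: iota_mul mul_add mul_smul j_mul_j_mul algebra_simps)

lemma mul_iota: "v \<in> W \<Longrightarrow> v \<star> \<iota> s = \<iota> (hconj L s) \<star> v"
  using mul_cj_swap[of v "\<iota> (hconj L s)"] polar_iota[of v "hconj L s"]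
  by (simp add: W_D iota_hconj)

text \<open>The swapping rules pull both coefficients out. The scalar part becomes sesquilinear like
  \<sigma>, the W-part conjugate-linear in both arguments like the cross product.\<close>

lemma iota_mul_iota_mul:
  assumes "u \<in> W" "v \<in> W" "z \<in> W" "u \<star> v = c \<diamondop> e + z"
  shows "(\<iota> s \<star> u) \<star> (\<iota> t \<star> v) =
    c \<diamondop> \<iota> (mul L s (hconj L t)) + \<iota> (mul L (hconj L s) (hconj L t)) \<star> z"
proof -
  have "(\<iota> s \<star> u) \<star> (\<iota> t \<star> v) = (u \<star> (\<iota> t \<star> v)) \<star> \<iota> s"
    using assms iota_mul_W[of v t] by (intro mul_mul_swap) (simp_all add: W_D polar_iota)
  also have "\<dots> = (\<iota> (hconj L t) \<star> (u \<star> v)) \<star> \<iota> s"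
    using assms by (subst mul_swap_left) (simp_all add: W_D polar_iota iota_hconj)
  also have "\<dots> = c \<diamondop> (\<iota> (hconj L t) \<star> \<iota> s) + (\<iota> (hconj L t) \<star> z) \<star> \<iota> s"
    by (simp add: assms(4) mul_add add_mul mul_smul smul_mul)
  also have "(\<iota> (hconj L t) \<star> z) \<star> \<iota> s = \<iota> (hconj L s) \<star> (\<iota> (hconj L t) \<star> z)"
    by (rule mul_iota[OF iota_mul_W[OF assms(3)]])
  finally show ?thesis
    by (simp add: iota_iota_mul L.mul_commute flip: iota_times)
qed

lemma minus_eq_add: "- v = v + v" for v :: 'b
  using triple_vec[of v] by (simp add: neg_eq_iff_add_eq_0 add.assoc)

text \<open>In characteristic 3 this is w_1 + w_2 + w_3 plus the vector with index i, matching I + M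
  in \<open>cross_prod_eq\<close>.\<close>

definition yv :: "3 \<Rightarrow> 'b" where "yv i = wv (i + 1) + wv (i + 2) - wv i"

lemma tau_iota: "\<tau> (\<iota> s) = \<iota> s"
  by (simp add: \<iota>_def tau_add tau_smul)

text \<open>Applying \<tau> to the first product gives the next two; the reversed ones follow from
  uv + vu = -N(u,v)1 on W and -1 - 1 = 1. Even the squares have the shape
  \<open>c \<diamondop> e + z\<close> that \<open>iota_mul_iota_mul\<close> expects.\<close>

lemma products:
  "wv 1 \<star> wv 2 = 1 \<diamondop> e + \<iota> k \<star> yv 0"
  "wv 2 \<star> wv 0 = 1 \<diamondop> e + \<iota> k \<star> yv 1"
  "wv 0 \<star> wv 1 = 1 \<diamondop> e + \<iota> k \<star> yv 2"
  "wv 2 \<star> wv 1 = 1 \<diamondop> e + - (\<iota> k \<star> yv 0)"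
  "wv 0 \<star> wv 2 = 1 \<diamondop> e + - (\<iota> k \<star> yv 1)"
  "wv 1 \<star> wv 0 = 1 \<diamondop> e + - (\<iota> k \<star> yv 2)"
  "wv i \<star> wv i = 0 \<diamondop> e + 0"
proof -
  show 1: "wv 1 \<star> wv 2 = 1 \<diamondop> e + \<iota> k \<star> yv 0"
    by (simp add: product_12' yv_def)
  show 2: "wv 2 \<star> wv 0 = 1 \<diamondop> e + \<iota> k \<star> yv 1"
    using arg_cong[OF 1, of \<tau>]
    by (simp add: tau_mul tau_wv tau_add tau_iota yv_def tau_diff)
  show 3: "wv 0 \<star> wv 1 = 1 \<diamondop> e + \<iota> k \<star> yv 2"
    using arg_cong[OF 2, of \<tau>]
    by (simp add: tau_mul tau_wv tau_add tau_iota yv_def tau_diff)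
  have cjw: "cj (wv i) = - wv i" for i
    using wv_W[of i] by (simp add: cj_eq_minus W_D)
  have rev: "b \<star> a = 1 \<diamondop> e + - z"
    if "a \<star> b = 1 \<diamondop> e + z" "N a b = 1" "cj a = - a" "cj b = - b" for a b z
  proof -
    have "- (a \<star> b) - b \<star> a = e"
      using mul_mul_cj_linearized[of e a b] that by (simp add: mul_minus)
    then have "b \<star> a = - e + - e + - z"
      using that(1) by (simp add: algebra_simps)
    also have "- e + - e = e"
      using minus_eq_add[of "- e"] by simp
    finally show ?thesis by simp
  qed
  show "wv 2 \<star> wv 1 = 1 \<diamondop> e + - (\<iota> k \<star> yv 0)"
    by (rule rev[OF 1]) (simp_all add: gram \<epsilon>_def eps_1 cjw)
  show "wv 0 \<star> wv 2 = 1 \<diamondop> e + - (\<iota> k \<star> yv 1)"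
    by (rule rev[OF 2]) (simp_all add: gram \<epsilon>_def eps_1 cjw)
  show "wv 1 \<star> wv 0 = 1 \<diamondop> e + - (\<iota> k \<star> yv 2)"
    by (rule rev[OF 3]) (simp_all add: gram \<epsilon>_def eps_1 cjw)
  show "wv i \<star> wv i = 0 \<diamondop> e + 0"
    using wv_W[of i] by (simp add: mul_self nrm_wv W_D)
qed

lemma yv_W: "yv i \<in> W"
  unfolding yv_def by (intro W_intros wv_W)

lemma f_mul: "f (mul (KW_algebra L d) s t) = f s \<star> f t"
proof (cases s; cases t)
  fix b x c y assume s: "s = (b, x)" and t: "t = (c, y)"
  \<comment> \<open>The coefficient of \<open>yv i\<close> in the product. Expanding each
    \<open>yv i\<close> in the basis adds the sum of all \<open>E\<close> to each coordinate, as in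
    the cross product.\<close>
  define E where "E i = mul L k (hconj L (L.minor x y $ i))" for i
  have cross: "cross_prod L d x y $ i = E i + (E 0 + E 1 + E 2)" for i
    by (simp add: L.cross_prod_eq E_def L.cj_mul' L.cj_add L.mul_add csum_def cj_d)
  have AB: "(\<iota> (x $ i) \<star> wv i) \<star> (\<iota> (y $ i) \<star> wv i) = 0" for i
    by (subst iota_mul_iota_mul[OF wv_W wv_W _ products(7)]) (simp_all add: W_def)
  have ww: "(\<iota> (x $ i) \<star> wv i) \<star> (\<iota> (y $ i') \<star> wv i') = \<iota> (mul L (x $ i) (hconj L (y $ i')))
      + \<iota> (mul L k (mul L (hconj L (x $ i)) (hconj L (y $ i')))) \<star> z"
    if "wv i \<star> wv i' = 1 \<diamondop> e + \<iota> k \<star> z" "z \<in> W" for i i' z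
    using iota_mul_iota_mul[OF wv_W wv_W iota_mul_W[OF that(2)] that(1)]
    by (simp add: iota_iota_mul L.mul_ac)
  \<comment> \<open>The sign moves into the vector, so that \<open>ww\<close> also covers the
    reversed products.\<close>
  have pr: "wv 2 \<star> wv 1 = 1 \<diamondop> e + \<iota> k \<star> (- yv 0)"
    "wv 0 \<star> wv 2 = 1 \<diamondop> e + \<iota> k \<star> (- yv 1)"
    "wv 1 \<star> wv 0 = 1 \<diamondop> e + \<iota> k \<star> (- yv 2)"
    by (simp_all only: products mul_minus)
  note ws = ww[OF products(1) yv_W] ww[OF products(2) yv_W] ww[OF products(3) yv_W]
    ww[OF pr(1) W_minus[OF yv_W]] ww[OF pr(2) W_minus[OF yv_W]] ww[OF pr(3) W_minus[OF yv_W]]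
  define A B where "A = \<iota> (x $ 0) \<star> wv 0 + \<iota> (x $ 1) \<star> wv 1 + \<iota> (x $ 2) \<star> wv 2"
    and "B = \<iota> (y $ 0) \<star> wv 0 + \<iota> (y $ 1) \<star> wv 1 + \<iota> (y $ 2) \<star> wv 2"
  have "A \<star> B = \<iota> (- sigma_form L x y) + (\<iota> (E 0) \<star> yv 0 + \<iota> (E 1) \<star> yv 1 + \<iota> (E 2) \<star> yv 2)"
    by (simp add: A_def B_def add_mul mul_add AB ws E_def L.minor_def L.sigma_form_eq L.cj_add
        L.mul_add L.mul_diff L.cj_diff L.cj_mul' iota_add iota_diff iota_minus mul_minus diff_mul
        algebra_simps)
  also have "\<iota> (E 0) \<star> yv 0 + \<iota> (E 1) \<star> yv 1 + \<iota> (E 2) \<star> yv 2 =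
    \<iota> (cross_prod L d x y $ 0) \<star> wv 0 + \<iota> (cross_prod L d x y $ 1) \<star> wv 1
      + \<iota> (cross_prod L d x y $ 2) \<star> wv 2"
    by (simp add: cross yv_def iota_add add_mul mul_add mul_diff)
      (simp only: diff_conv_add_uminus minus_eq_add add_ac)
  finally have AB: "A \<star> B = \<iota> (- sigma_form L x y) + (\<iota> (cross_prod L d x y $ 0) \<star> wv 0
    + \<iota> (cross_prod L d x y $ 1) \<star> wv 1 + \<iota> (cross_prod L d x y $ 2) \<star> wv 2)" .
  have bB: "\<iota> b \<star> B = \<iota> (mul L b (y $ 0)) \<star> wv 0 + \<iota> (mul L b (y $ 1)) \<star> wv 1
    + \<iota> (mul L b (y $ 2)) \<star> wv 2"
    by (simp add: B_def mul_add iota_iota_mul)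
  have Ac: "A \<star> \<iota> c = \<iota> (mul L (hconj L c) (x $ 0)) \<star> wv 0 + \<iota> (mul L (hconj L c) (x $ 1)) \<star> wv 1
    + \<iota> (mul L (hconj L c) (x $ 2)) \<star> wv 2"
    by (simp add: A_def add_mul mul_iota[OF iota_mul_W[OF wv_W]] iota_iota_mul)
  have "f s = \<iota> b + A" "f t = \<iota> c + B"
    by (simp_all add: f_def s t A_def B_def)
  then have "f s \<star> f t = \<iota> b \<star> \<iota> c + \<iota> b \<star> B + A \<star> \<iota> c + A \<star> B"
    by (simp add: add_mul mul_add add_ac)
  also have "\<dots> = f (mul (KW_algebra L d) s t)"
    unfolding AB bB Ac s t L.mul_KW f_def
    by (simp add: iota_add iota_diff iota_minus iota_times[symmetric] add_mul algebra_simps)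
  finally show ?thesis ..
qed

lemma f_iso: "alg_iso (KW_algebra L d) C f"
  unfolding alg_iso_def
proof (intro conjI allI)
  interpret A: vector_space "smul (KW_algebra L d)" by (rule L.vector_space_KW)
  show "Vector_Spaces.linear (smul (KW_algebra L d)) (smul C) f"
  proof unfold_locales
    show "f (smul (KW_algebra L d) c s) = c \<diamondop> f s" for c s
      by (cases s) (simp add: L.smul_KW f_def iota_smul smul_mul scale_right_distrib)
  qed (rule f_add)
qed (simp_all add: bij_f f_mul)

lemma tau_f: "\<tau> (f s) = f (tau_KW s)"
  by (cases s)
    (simp add: f_def tau_KW_def tau_add tau_mul tau_iota tau_wv add_ac)

end

lemma conjugate_auts_sym:
  assumes "alg_iso A B h" "\<And>x. g (h x) = h (f x)"
  shows "conjugate_auts B g A f"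
proof -
  have h: "bij h" "Vector_Spaces.linear (smul A) (smul B) h"
    using assms(1) by (simp_all add: alg_iso_def)
  define h' where "h' = inv_into UNIV h"
  have r: "h (h' x) = x" "h' (h y) = y" for x y
    using h(1) by (simp_all add: h'_def bij_is_surj bij_is_inj surj_f_inv_f)
  have inj: "h' x = y \<longleftrightarrow> x = h y" for x y
    using r by metis
  interpret Vector_Spaces.linear "smul A" "smul B" h by fact
  have "Vector_Spaces.linear (smul B) (smul A) (h')"
    by unfold_locales (simp_all add: inj add scale r)
  moreover have "h' (mul B x y) = mul A (h' x) (h' y)" for x y
    by (simp add: inj alg_iso_mul[OF assms(1)] r)
  moreover have "h' \<circ> g = f \<circ> h'"
    by (auto simp: fun_eq_iff inj assms(2)[symmetric] r)
  ultimately show ?thesis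
    unfolding conjugate_auts_def alg_iso_def using h(1) bij_imp_bij_inv[of h] unfolding h'_def by blast
qed

section \<open>Scalar extension to the split Okubo algebra\<close>

lemma vec_cayley_eq_iff:
  "(x :: 'a ^ cayley_index) = y \<longleftrightarrow> x $ E1 = y $ E1 \<and> x $ E2 = y $ E2
    \<and> (\<forall>i. x $ U i = y $ U i) \<and> (\<forall>i. x $ V i = y $ V i)"
  unfolding vec_eq_iff by (metis cayley_index.exhaust)

lemma smul_split_cayley [simp]: "smul split_cayley = (*s)"
  by (simp add: split_cayley_def)

text \<open>Zorn's vector matrices: dot products on the diagonal, cross products off it.\<close>

lemma mul_split_cayley:
  fixes x y :: "'f::field ^ cayley_index"
  shows "mul split_cayley x y $ E1 = x $ E1 * y $ E1
      - (x $ U 0 * y $ V 0 + x $ U 1 * y $ V 1 + x $ U 2 * y $ V 2)"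
    "mul split_cayley x y $ E2 = x $ E2 * y $ E2
      - (x $ V 0 * y $ U 0 + x $ V 1 * y $ U 1 + x $ V 2 * y $ U 2)"
    "mul split_cayley x y $ U i = x $ E1 * y $ U i + x $ U i * y $ E2
      + (x $ V (i + 1) * y $ V (i + 2) - x $ V (i + 2) * y $ V (i + 1))"
    "mul split_cayley x y $ V i = x $ E2 * y $ V i + x $ V i * y $ E1
      + (x $ U (i + 1) * y $ U (i + 2) - x $ U (i + 2) * y $ U (i + 1))"
proof -
  have "\<forall>i. mul split_cayley x y $ U i = x $ E1 * y $ U i + x $ U i * y $ E2
      + (x $ V (i + 1) * y $ V (i + 2) - x $ V (i + 2) * y $ V (i + 1))"
    unfolding all_3 by (simp add: split_cayley_def sum_cayley_index cb_def axis_def)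
  then show "mul split_cayley x y $ U i = x $ E1 * y $ U i + x $ U i * y $ E2
      + (x $ V (i + 1) * y $ V (i + 2) - x $ V (i + 2) * y $ V (i + 1))" by blast
  have "\<forall>i. mul split_cayley x y $ V i = x $ E2 * y $ V i + x $ V i * y $ E1
      + (x $ U (i + 1) * y $ U (i + 2) - x $ U (i + 2) * y $ U (i + 1))"
    unfolding all_3 by (simp add: split_cayley_def sum_cayley_index cb_def axis_def)
  then show "mul split_cayley x y $ V i = x $ E2 * y $ V i + x $ V i * y $ E1
      + (x $ U (i + 1) * y $ U (i + 2) - x $ U (i + 2) * y $ U (i + 1))" by blast
qed (simp_all add: split_cayley_def sum_cayley_index cb_def axis_def)

lemma hconj_split_cayley:
  fixes x :: "'f::field ^ cayley_index"
  shows "hconj split_cayley x $ E1 = x $ E2" "hconj split_cayley x $ E2 = x $ E1"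
    "hconj split_cayley x $ U i = - x $ U i" "hconj split_cayley x $ V i = - x $ V i"
  by (simp_all add: hconj_def polar_def split_cayley_def cb_def axis_def algebra_simps)

lemma tau_st_nth:
  fixes x :: "'f::field ^ cayley_index"
  shows "tau_st x $ E1 = x $ E1" "tau_st x $ E2 = x $ E2"
    "tau_st x $ U i = x $ U (i - 1)" "tau_st x $ V i = x $ V (i - 1)"
proof -
  have "\<forall>i. tau_st x $ U i = x $ U (i - 1)" "\<forall>i. tau_st x $ V i = x $ V (i - 1)"
    unfolding all_3 by (simp_all add: tau_st_def sum_cayley_index cb_def axis_def)
  then show "tau_st x $ U i = x $ U (i - 1)" "tau_st x $ V i = x $ V (i - 1)" by blast+
qed (simp_all add: tau_st_def sum_cayley_index cb_def axis_def)

lemma mul_split_okubo: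
  "mul split_okubo x y =
    mul split_cayley (tau_st (hconj split_cayley x)) (tau_st (tau_st (hconj split_cayley y)))"
  by (simp add: split_okubo_def petersson_def)

lemma mul_split_okubo_bilinear:
  fixes x y z :: "'f::field ^ cayley_index"
  shows "mul split_okubo (x + y) z = mul split_okubo x z + mul split_okubo y z"
    "mul split_okubo z (x + y) = mul split_okubo z x + mul split_okubo z y"
    "mul split_okubo (c *s x) y = c *s mul split_okubo x y"
    "mul split_okubo x (c *s y) = c *s mul split_okubo x y"
  by (simp_all add: vec_cayley_eq_iff mul_split_okubo mul_split_cayley tau_st_nth
      hconj_split_cayley algebra_simps)

text \<open>Settles the condition on bases in \<open>scalar_extension\<close>: the image of a basis
  still spans, and as many spanning vectors as the dimension must be distinct and
  independent.\<close>

lemma semilinear_image_basis: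
  fixes s :: "'f::field \<Rightarrow> 'a::ab_group_add \<Rightarrow> 'a" and h :: "'a \<Rightarrow> 'l::field ^ 'n"
  assumes "vector_space s" and T: "is_basis s T" and dim: "vector_space.dim s UNIV = CARD('n)"
    and add: "\<And>x y. h (x + y) = h x + h y" and scale: "\<And>c x. h (s c x) = \<iota> c *s h x"
    and span: "vec.span (range h) = UNIV"
  shows "inj_on h T \<and> is_basis (*s) (h ` T)"
proof -
  interpret A: vector_space s by fact
  have indep: "A.independent T" and spanT: "A.span T = UNIV"
    using T by (simp_all add: is_basis_def)
  have card: "card T = CARD('n)"
    using A.basis_card_eq_dim[of T UNIV] indep spanT dim by simp
  then have "finite T" by (metis card.infinite zero_less_card_finite less_irrefl)
  have h0: "h 0 = 0" using add[of 0 0] by simp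
  have "h x \<in> vec.span (h ` T)" for x
  proof -
    have "x \<in> A.span T" using spanT by simp
    then show ?thesis
      by (induction rule: A.span_induct_alt)
        (auto simp: h0 add scale vec.span_zero vec.span_add vec.span_scale vec.span_base)
  qed
  then have "vec.span (range h) \<subseteq> vec.span (h ` T)"
    by (intro vec.span_minimal) auto
  with span have sp: "vec.span (h ` T) = UNIV" by auto
  have dn: "vec.dim (UNIV :: ('l ^ 'n) set) = CARD('n)"
    by (simp add: vec.dim_UNIV card_cart_basis)
  have "CARD('n) \<le> card (h ` T)"
    using vec.dim_le_card[of UNIV "h ` T"] sp dn \<open>finite T\<close> by simp
  moreover have le: "card (h ` T) \<le> CARD('n)"
    using card_image_le[OF \<open>finite T\<close>, of h] card by simp
  ultimately have "inj_on h T"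
    using \<open>finite T\<close> card by (intro eq_card_imp_inj_on) simp_all
  moreover have "vec.independent (h ` T)"
    using vec.card_le_dim_spanning[of "h ` T" UNIV] sp dn le \<open>finite T\<close> by simp
  ultimately show ?thesis
    using sp by (simp add: is_basis_def)
qed

text \<open>With M the all-ones matrix, (I + M)^2 = I - M in characteristic 3: adding the coordinate
  sum to each coordinate turns the dot product into the Gram matrix of \<sigma>.\<close>

lemma circulant_pairing:
  fixes x0 x1 x2 y0 y1 y2 :: "'a::field"
  assumes "(3::'a) = 0"
  shows "(x0 + x1 + x2 + x0) * (y0 + y1 + y2 + y0) + (x0 + x1 + x2 + x1) * (y0 + y1 + y2 + y1)
    + (x0 + x1 + x2 + x2) * (y0 + y1 + y2 + y2)
    = - (x0 * (y1 + y2) + x1 * (y0 + y2) + x2 * (y0 + y1))"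
proof -
  \<comment> \<open>An explicit multiple of 3 makes the identity valid in every commutative
    ring.\<close>
  have "(x0 + x1 + x2 + x0) * (y0 + y1 + y2 + y0) + (x0 + x1 + x2 + x1) * (y0 + y1 + y2 + y1)
    + (x0 + x1 + x2 + x2) * (y0 + y1 + y2 + y2)
    = - (x0 * (y1 + y2) + x1 * (y0 + y2) + x2 * (y0 + y1))
      + 3 * (2 * (x0 + x1 + x2) * (y0 + y1 + y2))"
    by (simp add: algebra_simps)
  then show ?thesis by (simp add: assms)
qed

text \<open>I + M has determinant 4 = 1 and cofactor matrix I - M = (I + M)^2. The right-hand side
  applies I + M twice: once for \<open>cross_prod_eq\<close>, once for the coordinates of
  \<open>J\<close>.\<close>

lemma circulant_minor:
  fixes x0 x1 x2 y0 y1 y2 :: "'a::field"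
  assumes "(3::'a) = 0"
  defines "D0 \<equiv> x1 * y2 - x2 * y1" and "D1 \<equiv> x2 * y0 - x0 * y2" and "D2 \<equiv> x0 * y1 - x1 * y0"
  shows "(x0 + x1 + x2 + x1) * (y0 + y1 + y2 + y2) - (x0 + x1 + x2 + x2) * (y0 + y1 + y2 + y1)
    = (D0 + (D0 + D1 + D2) + (D1 + (D0 + D1 + D2)) + (D2 + (D0 + D1 + D2)))
      + (D0 + (D0 + D1 + D2))"
proof -
  have "(x0 + x1 + x2 + x1) * (y0 + y1 + y2 + y2) - (x0 + x1 + x2 + x2) * (y0 + y1 + y2 + y1)
    = (D0 + (D0 + D1 + D2) + (D1 + (D0 + D1 + D2)) + (D2 + (D0 + D1 + D2)))
      + (D0 + (D0 + D1 + D2)) + 3 * (D0 - 2 * (D0 + D1 + D2))"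
    unfolding D0_def D1_def D2_def by (simp add: algebra_simps)
  then show ?thesis by (simp add: assms(1))
qed

section \<open>The embedding over the algebraic closure\<close>

context order3_aut_basis
begin

lemma f_hconj: "f (hconj L b, - x) = cj (f (b, x))"
proof -
  have "cj (\<iota> (x $ i) \<star> wv i) = - (\<iota> (x $ i) \<star> wv i)" for i
    using iota_mul_W[OF wv_W] by (simp add: cj_eq_minus W_D)
  then show ?thesis
    by (simp add: f_def cj_add iota_hconj iota_minus mul_minus)
qed

context
  fixes \<beta> \<gamma> :: "'a alg_closure"
  assumes \<beta>: "\<beta>\<^sup>2 = to_ac (- n j)" and \<gamma>: "\<gamma> ^ 3 = to_ac (fst d) + \<beta> * to_ac (snd d)"
begin

text \<open>\<open>pl\<close> and \<open>mi\<close> are the two homomorphisms from \<open>L\<close>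
  to the closure, sending j to \<beta> and to -\<beta>; conjugation interchanges them.\<close>

definition pl where "pl s = to_ac (fst s) + \<beta> * to_ac (snd s)"
definition mi where "mi s = to_ac (fst s) - \<beta> * to_ac (snd s)"

lemma pl_mi_simps:
  "pl (s + t) = pl s + pl t" "mi (s + t) = mi s + mi t"
  "pl (s - t) = pl s - pl t" "mi (s - t) = mi s - mi t"
  "pl (- s) = - pl s" "mi (- s) = - mi s"
  "pl (mul L s t) = pl s * pl t" "mi (mul L s t) = mi s * mi t"
  "pl (hconj L s) = mi s" "mi (hconj L s) = pl s" "pl 0 = 0" "mi 0 = 0"
  "pl (smul L c s) = to_ac c * pl s" "mi (smul L c s) = to_ac c * mi s"
proof -
  have b: "\<beta> * (\<beta> * z) = - to_ac (n j) * z" for z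
    using \<beta> by (simp add: power2_eq_square flip: mult.assoc)
  show "pl (mul L s t) = pl s * pl t" "mi (mul L s t) = mi s * mi t"
    by (cases s; cases t; simp add: pl_def mi_def algebra_simps b)+
  show "pl (hconj L s) = mi s" "mi (hconj L s) = pl s"
    "pl (smul L c s) = to_ac c * pl s" "mi (smul L c s) = to_ac c * mi s"
    by (cases s; simp add: pl_def mi_def algebra_simps)+
qed (simp_all add: pl_def mi_def algebra_simps)

lemma ac_three: "(3 :: 'a alg_closure) = 0"
  using three_0 by (metis to_ac_0 to_ac_numeral)

lemma beta_neq_0: "\<beta> \<noteq> 0"
  using \<beta> nrm_j by auto

lemma pl_d: "pl d = \<gamma> ^ 3" and mi_d: "\<gamma> ^ 3 * mi d = 1"
proof -
  show "pl d = \<gamma> ^ 3" by (simp add: pl_def \<gamma>)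
  moreover have "pl d * mi d = (to_ac (fst d))\<^sup>2 - \<beta>\<^sup>2 * (to_ac (snd d))\<^sup>2"
    by (simp add: pl_def mi_def algebra_simps power2_eq_square)
  then have "pl d * mi d = to_ac ((fst d)\<^sup>2 + n j * (snd d)\<^sup>2)"
    by (simp add: \<beta>)
  moreover have "(fst d)\<^sup>2 + n j * (snd d)\<^sup>2 = 1"
    using nrm_d by (cases d) simp
  ultimately show "\<gamma> ^ 3 * mi d = 1" by simp
qed

lemma gamma_neq_0: "\<gamma> \<noteq> 0"
  using mi_d by auto

text \<open>The coordinates at \<open>U\<close> and \<open>V\<close> come from \<open>w\<^sub>i \<mapsto> \<gamma>(u\<^sub>1 + u\<^sub>2 + u\<^sub>3 + u\<^sub>i) + \<gamma>\<^sup>-\<^sup>1(v\<^sub>1 + v\<^sub>2 + v\<^sub>3 + v\<^sub>i)\<close>: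
  the normalization of the preceding sections applied to \<open>u\<^sub>i + v\<^sub>i\<close> and \<open>\<tau>\<^sub>s\<^sub>t\<close>.\<close>

definition J :: "('a \<times> 'a) \<times> (('a \<times> 'a) ^ 3) \<Rightarrow> 'a alg_closure ^ cayley_index" where
  "J = (\<lambda>(b, x). \<chi> c. case c of E1 \<Rightarrow> pl b | E2 \<Rightarrow> mi b
     | U i \<Rightarrow> \<gamma> * pl (csum x + x $ i) | V i \<Rightarrow> inverse \<gamma> * mi (csum x + x $ i))"

lemma J_nth: "J (b, x) $ E1 = pl b" "J (b, x) $ E2 = mi b"
  "J (b, x) $ U i = \<gamma> * pl (csum x + x $ i)" "J (b, x) $ V i = inverse \<gamma> * mi (csum x + x $ i)"
  by (simp_all add: J_def)

lemma J_mul: "J (mul (KW_algebra L d) s t) = mul split_cayley (J s) (J t)"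
proof (cases s; cases t)
  fix b x c y assume s: "s = (b, x)" and t: "t = (c, y)"
  let ?X = "\<lambda>i. pl (x $ i)" and ?X' = "\<lambda>i. mi (x $ i)"
  let ?Y = "\<lambda>i. pl (y $ i)" and ?Y' = "\<lambda>i. mi (y $ i)"
  have gi: "\<gamma> * a * (inverse \<gamma> * b) = a * b" "inverse \<gamma> * a * (\<gamma> * b) = a * b" for a b
    using gamma_neq_0 by simp_all
  \<comment> \<open>Products of V-coordinates carry \<gamma>^-2 = \<gamma> mi(d), those of
    U-coordinates \<gamma>^2 = \<gamma>^-1 pl(d). This is why \<gamma> is a cube root of
    pl(d).\<close>
  have g2: "inverse \<gamma> * a * (inverse \<gamma> * b) = \<gamma> * (mi d * (a * b))" for a b
  proof -
    have "mi d = inverse \<gamma> ^ 3"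
      using mi_d gamma_neq_0 by (metis inverse_unique power_inverse)
    then show ?thesis using gamma_neq_0 by (simp add: power3_eq_cube)
  qed
  have g3: "\<gamma> * a * (\<gamma> * b) = inverse \<gamma> * (pl d * (a * b))" for a b
    using gamma_neq_0 by (simp add: pl_d power3_eq_cube)
  note P = circulant_pairing[OF ac_three] and M = circulant_minor[OF ac_three]
  note simps = L.mul_KW mul_split_cayley J_nth s t pl_mi_simps csum_def L.sigma_form_eq
  have "J (mul (KW_algebra L d) s t) $ E1 = mul split_cayley (J s) (J t) $ E1"
    using P[of "?X 0" "?X 1" "?X 2" "?Y' 0" "?Y' 1" "?Y' 2"]
    by (simp add: simps gi)
  moreover have "J (mul (KW_algebra L d) s t) $ E2 = mul split_cayley (J s) (J t) $ E2"
    using P[of "?X' 0" "?X' 1" "?X' 2" "?Y 0" "?Y 1" "?Y 2"]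
    by (simp add: simps gi)
  moreover have cyc: "csum z = z $ i + z $ (i + 1) + z $ (i + 2)" for z :: "('a \<times> 'a) ^ 3" and i
  proof -
    have "\<forall>i. csum z = z $ i + z $ (i + 1) + z $ (i + 2)"
      unfolding all_3 by (simp add: csum_def add_ac)
    then show ?thesis by blast
  qed
  define m where "m = L.minor x y"
  have cross: "pl (cross_prod L d x y $ i) = mi d * mi (m $ i + csum m)"
    "mi (cross_prod L d x y $ i) = pl d * pl (m $ i + csum m)" for i
    by (simp_all add: L.cross_prod_eq pl_mi_simps m_def)
  have three3: "i + 1 + 2 = i" "i + 2 + 1 = i" "i + 2 + 2 = i + 1" "i + 1 + 1 = i + 2" for i :: 3
    by (simp_all add: add.assoc)
  have mm: "pl (m $ i) = ?X (i + 1) * ?Y (i + 2) - ?X (i + 2) * ?Y (i + 1)"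
    "mi (m $ i) = ?X' (i + 1) * ?Y' (i + 2) - ?X' (i + 2) * ?Y' (i + 1)" for i
    by (simp_all add: m_def L.minor_def pl_mi_simps)
  have "J (mul (KW_algebra L d) s t) $ U i = mul split_cayley (J s) (J t) $ U i" for i
  proof -
    let ?S = "\<lambda>x. pl (x $ i) + pl (x $ (i + 1)) + pl (x $ (i + 2))"
    have "mul split_cayley (J s) (J t) $ U i = \<gamma> * (pl b * (?S y + ?Y i) + mi c * (?S x + ?X i)
      + mi d * (mi (csum x + x $ (i + 1)) * mi (csum y + y $ (i + 2))
        - mi (csum x + x $ (i + 2)) * mi (csum y + y $ (i + 1))))"
      by (simp add: mul_split_cayley J_nth s t g2 cyc[of x i] cyc[of y i] pl_mi_simps(1))
        (simp add: algebra_simps)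
    also have "mi (csum x + x $ (i + 1)) * mi (csum y + y $ (i + 2))
        - mi (csum x + x $ (i + 2)) * mi (csum y + y $ (i + 1))
      = mi (csum m) + mi (csum m) + mi (csum m) + mi (csum m) + mi (csum m) + mi (m $ i)"
      using M[of "?X' i" "?X' (i + 1)" "?X' (i + 2)" "?Y' i" "?Y' (i + 1)" "?Y' (i + 2)"]
      by (simp add: cyc[of _ i] pl_mi_simps mm three3)
    also have "\<gamma> * (pl b * (?S y + ?Y i) + mi c * (?S x + ?X i)
      + mi d * (mi (csum m) + mi (csum m) + mi (csum m) + mi (csum m) + mi (csum m) + mi (m $ i)))
      = J (mul (KW_algebra L d) s t) $ U i"
      by (simp add: L.mul_KW s t J_nth cyc[of "_ + _" i] pl_mi_simps cross)
        (simp add: cyc[of m i] pl_mi_simps algebra_simps)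
    finally show ?thesis ..
  qed
  moreover have "J (mul (KW_algebra L d) s t) $ V i = mul split_cayley (J s) (J t) $ V i" for i
  proof -
    let ?S = "\<lambda>x. mi (x $ i) + mi (x $ (i + 1)) + mi (x $ (i + 2))"
    have "mul split_cayley (J s) (J t) $ V i = inverse \<gamma> * (mi b * (?S y + ?Y' i) + pl c * (?S x + ?X' i)
      + pl d * (pl (csum x + x $ (i + 1)) * pl (csum y + y $ (i + 2))
        - pl (csum x + x $ (i + 2)) * pl (csum y + y $ (i + 1))))"
      by (simp add: mul_split_cayley J_nth s t g3 cyc[of x i] cyc[of y i] pl_mi_simps(2))
        (simp add: algebra_simps)
    also have "pl (csum x + x $ (i + 1)) * pl (csum y + y $ (i + 2))
        - pl (csum x + x $ (i + 2)) * pl (csum y + y $ (i + 1))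
      = pl (csum m) + pl (csum m) + pl (csum m) + pl (csum m) + pl (csum m) + pl (m $ i)"
      using M[of "?X i" "?X (i + 1)" "?X (i + 2)" "?Y i" "?Y (i + 1)" "?Y (i + 2)"]
      by (simp add: cyc[of _ i] pl_mi_simps mm three3)
    also have "inverse \<gamma> * (mi b * (?S y + ?Y' i) + pl c * (?S x + ?X' i)
      + pl d * (pl (csum m) + pl (csum m) + pl (csum m) + pl (csum m) + pl (csum m) + pl (m $ i)))
      = J (mul (KW_algebra L d) s t) $ V i"
      by (simp add: L.mul_KW s t J_nth cyc[of "_ + _" i] pl_mi_simps cross)
        (simp add: cyc[of m i] pl_mi_simps algebra_simps)
    finally show ?thesis ..
  qed
  ultimately show ?thesis
    unfolding vec_cayley_eq_iff by blast
qed

lemma J_add: "J (s + t) = J s + J t"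
  by (cases s; cases t)
    (simp add: vec_cayley_eq_iff J_nth pl_mi_simps csum_def algebra_simps)

lemma J_smul: "J (smul (KW_algebra L d) c s) = to_ac c *s J s"
  by (cases s)
    (simp add: vec_cayley_eq_iff J_nth L.smul_KW pl_mi_simps csum_def algebra_simps)

lemma J_tau: "J (tau_KW s) = tau_st (J s)"
  by (cases s) (simp add: vec_cayley_eq_iff J_nth tau_KW_def tau_st_nth csum_def add_ac)

lemma J_hconj: "J (hconj L b, - x) = hconj split_cayley (J (b, x))"
  by (simp add: vec_cayley_eq_iff J_nth hconj_split_cayley pl_mi_simps csum_def algebra_simps)

lemma span_range_J: "vec.span (range J) = UNIV"
proof -
  have "v \<in> vec.span (range J)" for v
  proof -
    define S T where "S = v $ U 0 + v $ U 1 + v $ U 2" and "T = v $ V 0 + v $ V 1 + v $ V 2"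
    \<comment> \<open>I - M inverts I + M, so subtracting the coordinate sum undoes the substitution
      in \<open>J\<close>.\<close>
    define x where "x i = inverse \<gamma> * (v $ U i - S)" for i
    define y where "y i = \<gamma> * (v $ V i - T)" for i
    \<comment> \<open>\<open>p\<close> and \<open>q\<close> solve p + \<beta>q = a and p - \<beta>q
      = b, so combining the images of s and js attains prescribed values in the \<open>pl\<close>
      and \<open>mi\<close> coordinates independently.\<close>
    define p where "p a b = (a + b) / 2" for a b :: "'a alg_closure"
    define q where "q a b = (a - b) / (2 * \<beta>)" for a b
    have two: "(2 :: 'a alg_closure) \<noteq> 0"
      using two_neq_0 by (metis to_ac_eq_0_iff to_ac_numeral)
    have pq: "p a b + \<beta> * q a b = a" "p a b - \<beta> * q a b = b" for a b
      using two beta_neq_0 by (simp_all add: p_def q_def field_simps)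
    define g where "g a b s t = p a b *s J s + q a b *s J t" for a b s t
    define u where "u = g (v $ E1) (v $ E2) ((1, 0), 0) ((0, 1), 0)
      + (\<Sum>i\<in>UNIV. g (x i) (y i) (0, axis i (1, 0)) (0, axis i (0, 1)))"
    have pl1: "pl (1, 0) = 1" "mi (1, 0) = 1" "pl (0, 1) = \<beta>" "mi (0, 1) = - \<beta>"
      by (simp_all add: pl_def mi_def)
    have sum3: "inverse \<gamma> * (a - (a + b + c)) + inverse \<gamma> * (b - (a + b + c))
        + inverse \<gamma> * (c - (a + b + c)) = inverse \<gamma> * (a + b + c)"
      "\<gamma> * (a - (a + b + c)) + \<gamma> * (b - (a + b + c)) + \<gamma> * (c - (a + b + c)) = \<gamma> * (a + b + c)"
      for a b c
    proof -
      have *: "(a - (a + b + c)) + (b - (a + b + c)) + (c - (a + b + c))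
        = (a + b + c) - 3 * (a + b + c)"
        by (simp add: algebra_simps)
      show "inverse \<gamma> * (a - (a + b + c)) + inverse \<gamma> * (b - (a + b + c))
          + inverse \<gamma> * (c - (a + b + c)) = inverse \<gamma> * (a + b + c)"
        "\<gamma> * (a - (a + b + c)) + \<gamma> * (b - (a + b + c)) + \<gamma> * (c - (a + b + c)) = \<gamma> * (a + b + c)"
        unfolding distrib_left[symmetric] * by (simp_all add: ac_three)
    qed
    have gE: "g a b ((1, 0), 0) ((0, 1), 0) $ E1 = a" "g a b ((1, 0), 0) ((0, 1), 0) $ E2 = b"
      "g a b ((1, 0), 0) ((0, 1), 0) $ U k = 0" "g a b ((1, 0), 0) ((0, 1), 0) $ V k = 0" for a b k
      using pq[of a b] by (simp_all add: g_def J_nth pl_mi_simps pl1 csum_def mult.commute)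
    have c: "csum (axis i z) = z" for i and z :: "'a \<times> 'a"
    proof -
      have "\<forall>i. csum (axis i z) = z" unfolding all_3 by (simp add: csum_def axis_def)
      then show ?thesis by blast
    qed
    have gW: "g a b (0, axis i (1, 0)) (0, axis i (0, 1)) $ E1 = 0"
      "g a b (0, axis i (1, 0)) (0, axis i (0, 1)) $ E2 = 0"
      "g a b (0, axis i (1, 0)) (0, axis i (0, 1)) $ U k = \<gamma> * (if i = k then a + a else a)"
      "g a b (0, axis i (1, 0)) (0, axis i (0, 1)) $ V k = inverse \<gamma> * (if i = k then b + b else b)"
      for a b i k
    proof -
      have ax: "axis i z $ k = (if i = k then z else 0)" for z :: "'a \<times> 'a"
        by (simp add: axis_def)
      have "g a b (0, axis i (1, 0)) (0, axis i (0, 1)) $ U k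
        = \<gamma> * (if i = k then (p a b + \<beta> * q a b) + (p a b + \<beta> * q a b) else p a b + \<beta> * q a b)"
        by (simp add: g_def J_nth pl_mi_simps pl1 c ax algebra_simps)
      then show "g a b (0, axis i (1, 0)) (0, axis i (0, 1)) $ U k = \<gamma> * (if i = k then a + a else a)"
        by (simp only: pq)
      have "g a b (0, axis i (1, 0)) (0, axis i (0, 1)) $ V k
        = inverse \<gamma> * (if i = k then (p a b - \<beta> * q a b) + (p a b - \<beta> * q a b)
            else p a b - \<beta> * q a b)"
        by (simp add: g_def J_nth pl_mi_simps pl1 c ax algebra_simps)
      then show "g a b (0, axis i (1, 0)) (0, axis i (0, 1)) $ V k
        = inverse \<gamma> * (if i = k then b + b else b)"
        by (simp only: pq)
    qed (simp_all add: g_def J_nth pl_mi_simps)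
    have uU1: "u $ U k = \<gamma> * (x 0 + x 1 + x 2 + x k)" for k
    proof -
      have "\<forall>k. u $ U k = \<gamma> * (x 0 + x 1 + x 2 + x k)"
        unfolding all_3 by (simp add: u_def sum_3' gE gW algebra_simps)
      then show ?thesis by blast
    qed
    have x_sum: "x 0 + x 1 + x 2 = inverse \<gamma> * S"
      unfolding x_def S_def by (rule sum3)
    have uU: "u $ U k = v $ U k" for k
    proof -
      have "x 0 + x 1 + x 2 + x k = inverse \<gamma> * v $ U k"
        unfolding x_sum by (simp add: x_def flip: distrib_left)
      then show ?thesis
        unfolding uU1 using gamma_neq_0 by simp
    qed
    have uV1: "u $ V k = inverse \<gamma> * (y 0 + y 1 + y 2 + y k)" for k
    proof -
      have "\<forall>k. u $ V k = inverse \<gamma> * (y 0 + y 1 + y 2 + y k)"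
        unfolding all_3 by (simp add: u_def sum_3' gE gW algebra_simps)
      then show ?thesis by blast
    qed
    have y_sum: "y 0 + y 1 + y 2 = \<gamma> * T"
      unfolding y_def T_def by (rule sum3)
    have uV: "u $ V k = v $ V k" for k
    proof -
      have "y 0 + y 1 + y 2 + y k = \<gamma> * v $ V k"
        unfolding y_sum by (simp add: y_def flip: distrib_left)
      then show ?thesis
        unfolding uV1 using gamma_neq_0 by simp
    qed
    have "u = v"
      by (simp add: vec_cayley_eq_iff uU uV) (simp add: u_def sum_3' gE gW)
    moreover have "u \<in> vec.span (range J)"
      unfolding u_def g_def
      by (intro vec.span_add vec.span_sum vec.span_scale vec.span_base rangeI)
    ultimately show ?thesis by simp
  qed
  then show ?thesis by blast
qed

lemma okubo_if_roots: "okubo_algebra (petersson C \<tau>)"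
proof -
  \<comment> \<open>\<open>okubo_algebra\<close> asks for a record without norm: \<open>B\<close> is
    \<open>split_okubo\<close> with the norm forgotten, and the isomorphism is
    \<open>id\<close>.\<close>
  define B :: "('a alg_closure, 'a alg_closure ^ cayley_index) alg"
    where "B = \<lparr>smul = (*s), mul = mul split_okubo\<rparr>"
  obtain f' where f': "\<And>s. f' (f s) = s" "\<And>x. f (f' x) = x"
    using bij_f by (metis bij_inv_eq_iff)
  define h where "h x = J (f' x)" for x
  have hf: "h (f s) = J s" for s by (simp add: h_def f')
  have h_add: "h (x + y) = h x + h y" for x y
    by (metis f'(2) f_add hf J_add)
  have h_smul: "h (c \<diamondop> x) = to_ac c *s h x" for c x
    by (metis f'(2) alg_iso_smul[OF f_iso] hf J_smul)
  have h_mul: "h (x \<star> y) = mul split_cayley (h x) (h y)" for x y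
    by (metis f'(2) f_mul hf J_mul)
  have h_tau: "h (\<tau> x) = tau_st (h x)" for x
    by (metis f'(2) tau_f hf J_tau)
  have h_cj: "h (cj x) = hconj split_cayley (h x)" for x
    by (metis f'(2) f_hconj hf J_hconj surj_pair)
  have "range h = range J"
  proof
    show "range h \<subseteq> range J" by (auto simp: h_def)
    show "range J \<subseteq> range h" by (auto simp flip: hf)
  qed
  then have span: "vec.span (range h) = UNIV" by (simp add: span_range_J)
  have "scalar_extension to_ac (petersson C \<tau>) B h"
    unfolding scalar_extension_def
  proof (intro conjI allI impI)
    show "vector_space (smul (petersson C \<tau>))"
      by (simp add: petersson_def vector_space_axioms)
    show "vector_space (smul B)"
      by (simp add: B_def vec.vector_space_axioms)
    show "h (mul (petersson C \<tau>) x y) = mul B (h x) (h y)" for x y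
      by (simp add: petersson_def B_def mul_split_okubo h_mul h_tau h_cj)
    show "inj_on h T" "is_basis (smul B) (h ` T)" if "is_basis (smul (petersson C \<tau>)) T" for T
      using semilinear_image_basis[OF vector_space_axioms, of T h to_ac] that
      by (simp_all add: petersson_def B_def dim_UNIV card_cayley_index h_add h_smul span)
  qed (simp_all add: B_def mul_split_okubo_bilinear petersson_def h_add h_smul)
  moreover have "alg_iso B split_okubo id"
    by (simp add: alg_iso_def B_def vec.linear_id split_okubo_def petersson_def)
  ultimately show ?thesis
    unfolding okubo_algebra_def by blast
qed

end

lemma okubo: "okubo_algebra (petersson C \<tau>)"
proof -
  obtain \<beta> :: "'a alg_closure" where "\<beta>\<^sup>2 = to_ac (- n j)"
    using nth_root_exists[of 2] by auto
  moreover obtain \<gamma> :: "'a alg_closure" where "\<gamma> ^ 3 = to_ac (fst d) + \<beta> * to_ac (snd d)"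
    using nth_root_exists[of 3] by auto
  ultimately show ?thesis by (rule okubo_if_roots)
qed

end

section \<open>From the hypotheses to a normalized basis, and the theorem\<close>

lemma order3_aut_if_fixes_etale:
  fixes C :: "('f::field, 'c::ab_group_add) unital_normed_alg"
  assumes char3: "CHAR('f) = 3"
    and C: "cayley_algebra C" "alg_automorphism C \<tau>" "order_three \<tau>"
    and sq: "(\<lambda>x. \<tau> x - x) \<circ> (\<lambda>x. \<tau> x - x) \<noteq> (\<lambda>x. 0)"
    and S: "quadratic_etale_on C S" "\<forall>x\<in>S. \<tau> x = x"
  obtains j where "order3_aut C \<tau> j"
proof -
  interpret hurwitz_alg C
    using C(1) by (simp add: cayley_algebra_def hurwitz_alg_def)
  have dim: "dim UNIV = 8"
    using C(1) by (simp add: cayley_algebra_def)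
  have SS: "subspace S" "dim S = 2" "e \<in> S"
    and nondeg: "\<And>x. x \<in> S \<Longrightarrow> (\<And>y. y \<in> S \<Longrightarrow> N x y = 0) \<Longrightarrow> x = 0"
    using S(1) by (auto simp: quadratic_etale_on_def hurwitz_on_def)
  have "e \<noteq> 0"
  proof
    assume "e = 0"
    then have "x = 0" for x :: 'c
      using unity_mul[of x] by simp
    with sq show False by (auto simp: fun_eq_iff)
  qed
  then have ne: "n e = 1" by (rule nrm_unity_eq_1)
  have three: "(3::'f) = 0"
    using of_nat_CHAR[where 'a = 'f] char3 by simp
  have two: "(2::'f) \<noteq> 0"
  proof
    assume "(2::'f) = 0"
    then have "(3::'f) = 1" by (metis add_0 numeral_3_eq_3 one_add_one numeral_plus_one semiring_norm(5))
    with three show False by simp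
  qed
  obtain y where y: "y \<in> S" "y \<notin> span {e}" "\<And>x. x \<in> S \<Longrightarrow> \<exists>p q. x = p \<diamondop> e + q \<diamondop> y"
    using dim_2_subspace_generator[OF SS \<open>e \<noteq> 0\<close>] by blast
  \<comment> \<open>The trace-zero part of \<open>y\<close>. If it were isotropic it would be
    orthogonal to all of \<open>S\<close>, against nondegeneracy.\<close>
  define j where "j = y - (N y e / 2) \<diamondop> e"
  have jS: "j \<in> S"
    using SS y by (auto simp: j_def intro: subspace_diff subspace_scale)
  have je: "N j e = 0"
    using two by (simp add: j_def polar_diff polar_smul_left polar_self ne)
  have "j \<noteq> 0"
    using y(2) by (auto simp: j_def span_singleton)
  have "n j \<noteq> 0"
  proof
    assume nj: "n j = 0"
    have "N j x = 0" if x: "x \<in> S" for x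
    proof -
      obtain p q where "x = p \<diamondop> e + q \<diamondop> y" using y(3)[OF x] by blast
      then have "x = (p + q * (N y e / 2)) \<diamondop> e + q \<diamondop> j"
        by (simp add: j_def algebra_simps)
      then show ?thesis
        by (simp add: polar_add_right polar_smul_right je polar_self nj)
    qed
    with nondeg[OF jS] \<open>j \<noteq> 0\<close> show False by blast
  qed
  moreover have t3: "\<tau> (\<tau> (\<tau> x)) = x" for x
    using C(3) by (simp add: order_three_def fun_eq_iff)
  moreover have "\<exists>x. x + \<tau> x + \<tau> (\<tau> x) \<noteq> 0"
  proof -
    obtain x where "\<tau> (\<tau> x - x) - (\<tau> x - x) \<noteq> 0"
      using sq by (auto simp: fun_eq_iff)
    \<comment> \<open>(\<tau> - 1)^2 = 1 + \<tau> + \<tau>^2 - 3\<tau>, and the last term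
      vanishes.\<close>
    moreover have "\<tau> (\<tau> x - x) - (\<tau> x - x) = x + \<tau> x + \<tau> (\<tau> x) - (\<tau> x + \<tau> x + \<tau> x)"
      by (simp add: alg_iso_diff[OF C(2)] algebra_simps)
    ultimately show ?thesis
      using char3_add[OF char3, of "\<tau> x"] by auto
  qed
  ultimately have "order3_aut C \<tau> j"
    using char3 dim C(2) je S(2) jS by unfold_locales auto
  then show ?thesis by (rule that)
qed

lemma (in order3_aut) exists_basis:
  obtains w k where "order3_aut_basis C \<tau> j w k"
proof -
  obtain w0 where "w0 \<in> W" "n w0 = 0" "N (\<tau> w0) w0 \<noteq> 0" "N (j \<star> \<tau> w0) w0 = 0"
    by (rule exists_normalized)
  then interpret w0: order3_aut_vec C \<tau> j w0
    by unfold_locales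
  obtain w where w: "order3_aut_vec C \<tau> j w" "N (\<tau> w) w = 1"
    by (rule w0.rescale)
  interpret w: order3_aut_vec C \<tau> j w by fact
  obtain p q where "w.wv 1 \<star> w.wv 2 = w.\<epsilon> \<diamondop> e + w.\<iota> (p, q) \<star> (w.wv 1 + w.wv 2 - w.wv 0)"
    "p\<^sup>2 + n j * q\<^sup>2 = w.\<epsilon>"
    by (rule w.product_12)
  then have "order3_aut_basis C \<tau> j w (p, q)"
    using w(2) by unfold_locales (simp_all add: w.\<epsilon>_def)
  then show ?thesis by (rule that)
qed

theorem theorem6p7:
  fixes C :: "('f::field, 'c::ab_group_add) unital_normed_alg"
    and \<tau> :: "'c \<Rightarrow> 'c"
    and K :: "('f, 'k::ab_group_add) unital_normed_alg"
    and K' :: "('f, 'l::ab_group_add) unital_normed_alg"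
    and a :: 'k and a' :: 'l
  assumes char3: "CHAR('f) = 3"
  shows
    "(cayley_algebra C \<and> alg_automorphism C \<tau> \<and> order_three \<tau> \<and>
      (\<lambda>x. \<tau> x - x) \<circ> (\<lambda>x. \<tau> x - x) \<noteq> (\<lambda>x. 0) \<and>
      (\<exists>S. quadratic_etale_on C S \<and> (\<forall>x\<in>S. \<tau> x = x))
      \<longrightarrow> okubo_algebra (petersson C \<tau>) \<and>
          (\<exists>(L :: ('f, 'f \<times> 'f) unital_normed_alg) d.
             quadratic_etale L \<and> nrm L d = 1 \<and>
             conjugate_auts C \<tau> (KW_algebra L d) tau_KW)) \<and>
     (quadratic_etale K \<and> nrm K a = 1 \<and> quadratic_etale K' \<and> nrm K' a' = 1
      \<longrightarrow> (conjugate_auts (KW_algebra K a) tau_KW (KW_algebra K' a') tau_KW \<longleftrightarrow>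
             (\<exists>\<phi>. alg_iso K K' \<phi> \<and> (\<exists>b'. \<phi> a = mul K' (mul K' (mul K' b' b') b') a'))) \<and>
          (\<forall>\<phi> b'. alg_iso K K' \<phi> \<and> \<phi> a = mul K' (mul K' (mul K' b' b') b') a'
             \<longrightarrow> nrm K' b' = 1))"
proof (rule conjI; rule impI)
  assume *: "cayley_algebra C \<and> alg_automorphism C \<tau> \<and> order_three \<tau> \<and>
      (\<lambda>x. \<tau> x - x) \<circ> (\<lambda>x. \<tau> x - x) \<noteq> (\<lambda>x. 0) \<and>
      (\<exists>S. quadratic_etale_on C S \<and> (\<forall>x\<in>S. \<tau> x = x))"
  then obtain S where S: "quadratic_etale_on C S" "\<forall>x\<in>S. \<tau> x = x" by blast
  from * have C: "cayley_algebra C" "alg_automorphism C \<tau>" "order_three \<tau>"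
    "(\<lambda>x. \<tau> x - x) \<circ> (\<lambda>x. \<tau> x - x) \<noteq> (\<lambda>x. 0)" by (iprover dest: conjunct1 conjunct2)+
  obtain j where "order3_aut C \<tau> j"
    by (rule order3_aut_if_fixes_etale[OF char3 C S])
  then obtain w k where "order3_aut_basis C \<tau> j w k"
    by (rule order3_aut.exists_basis)
  then interpret order3_aut_basis C \<tau> j w k .
  \<comment> \<open>\<open>f\<close> goes from the model to \<open>C\<close>, so the conjugacy comes
    from its inverse.\<close>
  have "conjugate_auts C \<tau> (KW_algebra L d) tau_KW"
    using f_iso tau_f by (rule conjugate_auts_sym)
  moreover have "quadratic_etale L"
    by (simp add: quadratic_etale_iff L.etale_alg_axioms)
  ultimately show "okubo_algebra (petersson C \<tau>) \<and>
          (\<exists>(L :: ('f, 'f \<times> 'f) unital_normed_alg) d.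
             quadratic_etale L \<and> nrm L d = 1 \<and>
             conjugate_auts C \<tau> (KW_algebra L d) tau_KW)"
    using okubo nrm_d by blast
next
  assume K: "quadratic_etale K \<and> nrm K a = 1 \<and> quadratic_etale K' \<and> nrm K' a' = 1"
  then interpret KW_pair K K'
    by (simp add: KW_pair_def KW_def KW_axioms_def char3 quadratic_etale_iff)
  show "(conjugate_auts (KW_algebra K a) tau_KW (KW_algebra K' a') tau_KW \<longleftrightarrow>
             (\<exists>\<phi>. alg_iso K K' \<phi> \<and> (\<exists>b'. \<phi> a = mul K' (mul K' (mul K' b' b') b') a'))) \<and>
          (\<forall>\<phi> b'. alg_iso K K' \<phi> \<and> \<phi> a = mul K' (mul K' (mul K' b' b') b') a'
             \<longrightarrow> nrm K' b' = 1)"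
  proof (intro conjI iffI allI impI)
    assume "conjugate_auts (KW_algebra K a) tau_KW (KW_algebra K' a') tau_KW"
    with K obtain \<phi> b where "alg_iso K K' \<phi>" "\<phi> a = mul K' (mul K' (mul K' b b) b) a'"
      using cube_if_conjugate by blast
    then show "\<exists>\<phi>. alg_iso K K' \<phi> \<and> (\<exists>b'. \<phi> a = mul K' (mul K' (mul K' b' b') b') a')"
      by blast
  next
    assume "\<exists>\<phi>. alg_iso K K' \<phi> \<and> (\<exists>b'. \<phi> a = mul K' (mul K' (mul K' b' b') b') a')"
    with K show "conjugate_auts (KW_algebra K a) tau_KW (KW_algebra K' a') tau_KW"
      using conjugate_if_cube by blast
  next
    fix \<phi> b'
    assume "alg_iso K K' \<phi> \<and> \<phi> a = mul K' (mul K' (mul K' b' b') b') a'"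
    with K show "nrm K' b' = 1"
      using nrm_cube_root_eq_1 by blast
  qed
qed

end
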